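(* For every $\Lambda\in\mathcal F$, $$\phi(\Lambda)^2=\tau^\star(\Lambda):=\min_{\nu\in\mathbb{R}^q,\ \tau\in\mathbb{R}}\ \tau\quad\text{subject to}\quad F_\Lambda(\nu,\tau):=\begin{bmatrix}P(\Lambda)\otimes I_N & G_{\rm r}(\Lambda,\nu) \\ G_{\rm r}(\Lambda,\nu)^{\top} & \tau I_N\end{bmatrix}\succeq0 .$$ This problem is strictly feasible and attains its optimum. If $\nu^\star$ is an optimal $\nu$, a raw gauge representative is recovered from the minimum-norm linear problem $$\mu^\star=\operatorname*{arg\,min}_{\mu\in\mathbb{R}^d}\ \tfrac12\lVert\mu\rVert^2\quad\text{subject to}\quad\operatorname{col}_{r=1}^N\bigl(S_r(\mu)^{\top}P(\Lambda)+P(\Lambda)S_r(\mu)\bigr)=\sum_{\ell=1}^q\nu_\ell^\star\mathcal B_\ell,$$ where $S_r(\mu)$ are the slices of $K(\mu)$. This reconstruction leaves the quadratic vector field and the value unchanged: $H(\Lambda,\mu^\star)(\mathbf w\otimes\mathbf w)=H(\Lambda)(\mathbf w\otimes\mathbf w)$ for all $\mathbf w$, and $\lVert J(\Lambda,\mu^\star)\rVert=\phi(\Lambda)$.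
   Context: Polynomial system: $\dot{\mathbf x}=\mathbf p(\mathbf x)$ with $\mathbf p\in\mathbb{R}[\mathbf x]^n$, $\mathbf p(\mathbf 0)=\mathbf 0$, and the standing assumption that the Jacobian $J_x(\mathbf p)|_{\mathbf 0}$ is Hurwitz (all eigenvalues have negative real part). $\lVert\cdot\rVert$ is the spectral norm for matrices and Euclidean norm for vectors. Fixed lift: $m\ge0$, $N=n+m$, $\mathbf g=(g_1,\dots,g_m)$ with each $g_i$ a monomial in $\mathbf x$ of degree at least $2$; $\Phi(\mathbf x)=(\mathbf x,\mathbf g(\mathbf x))\in\mathbb{R}^N$; coordinates $\mathbf w=(\mathbf x,\mathbf y)$. The lift is inner-quadratic: for each $i$ a factorization $g_i=a_ib_i$ is fixed, with $a_i,b_i\in\{x_1,\dots,x_n,y_1,\dots,y_{i-1}\}$ (the identity holding after substituting $\mathbf y=\mathbf g(\mathbf x)$). Stabilizers: $h_i=y_i-a_ib_i$. Reference extension: $\mathbf F_0(\mathbf w)=A_0\mathbf w+H_0(\mathbf w\otimes\mathbf w)$, a vector field on $\mathbb{R}^N$ with polynomial components of total degree at most two, satisfying $\mathbf F_0(\Phi(\mathbf x))=J_x(\Phi)(\mathbf x)\mathbf p(\mathbf x)$ for all $\mathbf x$. Stabilized family: for $\Lambda\in\mathbb{R}^m$, $\mathbf F_\Lambda=\mathbf F_0-\sum_i\lambda_i\mathbf e_{n+i}h_i=A(\Lambda)\mathbf w+H(\Lambda)(\mathbf w\otimes\mathbf w)$ with $A(\Lambda)=A_0-\sum_i\lambda_i\mathbf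 e_{n+i}\mathbf e_{n+i}^{\top}$, $H(\Lambda)=H_0+\sum_i\lambda_i\mathbf e_{n+i}s_i^{\top}$, where $s_i\in\mathbb{R}^{N^2}$ satisfies $s_i^{\top}(\mathbf w\otimes\mathbf w)=a_ib_i$. Let $\mathcal F=\{\Lambda:A(\Lambda)\text{ Hurwitz}\}$. Gauge: let $\mathcal K=\{K\in\mathbb{R}^{N\times N^2}:K(\mathbf w\otimes\mathbf w)=0\ \forall\mathbf w\}$, of dimension $d=\frac12N^2(N-1)$, with fixed basis $\{K_k\}$; $K(\mu)=\sum_k\mu_kK_k$ with slices $(S_i(\mu))_{rj}:=(K(\mu))_{r,(i-1)N+j}$, and $H(\Lambda,\mu)=H(\Lambda)+K(\mu)$, $\mu\in\mathbb{R}^d$. Certificate: for $\Lambda\in\mathcal F$, $P(\Lambda)\succ0$ is the unique solution of $A(\Lambda)^{\top}P+PA(\Lambda)=-I_N$, factored as $P=P_f^{\top}P_f$. With blocks $(M_i)_{rj}:=(H(\Lambda,\mu))_{r,(i-1)N+j}$, let $G(\Lambda,\mu):=\operatorname{col}_{i=1}^N(M_i^{\top}P+PM_i)\in\mathbb{R}^{N^2\times N}$ ($\operatorname{col}$ = vertical stacking) and $J(\Lambda,\mu):=(P_f^{\top}\otimes I_N)^{-1}G(\Lambda,\mu)$. Put $\phi(\Lambda)=\min_{\mu\in\mathbb{R}^d}\lVert J(\Lambda,\mu)\rVert$. Reduced coordinates: with $\mathbb{S}^N$ the symmetric $N\times N$ matrices, let $$\mathcal C:=\{(B_i)_{i=1}^N\in(\mathbb{S}^N)^N:(B_i)_{jk}+(B_j)_{ki}+(B_k)_{ij}=0\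 \text{for all }i,j,k\},$$ which has dimension $q=N(N^2-1)/3$. Fix a basis $(B_1^{(\ell)},\dots,B_N^{(\ell)})$, $\ell=1,\dots,q$, of $\mathcal C$ and put $\mathcal B_\ell:=\operatorname{col}_{r=1}^NB_r^{(\ell)}$ and $G_{\rm r}(\Lambda,\nu):=G(\Lambda,0)+\sum_{\ell=1}^q\nu_\ell\mathcal B_\ell$. *)

theory Defs
  imports Complex_Main
    "Jordan_Normal_Form.Char_Poly"
    "Jordan_Normal_Form.Gauss_Jordan_Elimination"
begin

text \<open>All indices are zero-based: the entry with (one-based) column index $(i-1)N+j$ of an
  $N \times N^2$ matrix has the column index $i N + j$ here, and the lifted coordinate $y_i$ of
  $w = (x,y)$ is the entry $n + i$ of $w$.\<close>

definition euclid_norm :: "real vec \<Rightarrow> real" where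
  "euclid_norm v = sqrt (v \<bullet> v)"

text \<open>The operator norm induced by the Euclidean norms.\<close>
definition spectral_norm :: "real mat \<Rightarrow> real" where
  "spectral_norm M =
     (SUP v \<in> {v \<in> carrier_vec (dim_col M). euclid_norm v \<le> 1}. euclid_norm (M *\<^sub>v v))"

definition symmetric_mat :: "'a mat \<Rightarrow> bool" where
  "symmetric_mat M \<longleftrightarrow> transpose_mat M = M"

definition psd_mat :: "real mat \<Rightarrow> bool" where
  "psd_mat M \<longleftrightarrow> symmetric_mat M \<and> (\<forall>v \<in> carrier_vec (dim_row M). 0 \<le> v \<bullet> (M *\<^sub>v v))"

definition pd_mat :: "real mat \<Rightarrow> bool" where
  "pd_mat M \<longleftrightarrow> symmetric_mat M \<and>
     (\<forall>v \<in> carrier_vec (dim_row M). v \<noteq> 0\<^sub>v (dim_row M) \<longrightarrow> 0 < v \<bullet> (M *\<^sub>v v))"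

definition hurwitz :: "real mat \<Rightarrow> bool" where
  "hurwitz M \<longleftrightarrow> (\<forall>z. eigenvalue (map_mat complex_of_real M) z \<longrightarrow> Re z < 0)"

definition kron_mat :: "real mat \<Rightarrow> real mat \<Rightarrow> real mat" where
  "kron_mat A B = mat (dim_row A * dim_row B) (dim_col A * dim_col B)
     (\<lambda>(r, c). A $$ (r div dim_row B, c div dim_col B) * B $$ (r mod dim_row B, c mod dim_col B))"

definition kron_vec :: "real vec \<Rightarrow> real vec \<Rightarrow> real vec" where
  "kron_vec u v = vec (dim_vec u * dim_vec v) (\<lambda>k. u $ (k div dim_vec v) * v $ (k mod dim_vec v))"

definition outer :: "real vec \<Rightarrow> real vec \<Rightarrow> real mat" where
  "outer u v = mat (dim_vec u) (dim_vec v) (\<lambda>(r, c). u $ r * v $ c)"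

text \<open>The linear combination $\sum_k c_k M_k$ of $nr \times nc$ matrices, over $k <$ \<open>dim_vec c\<close>.\<close>
definition lin_comb :: "nat \<Rightarrow> nat \<Rightarrow> real vec \<Rightarrow> (nat \<Rightarrow> real mat) \<Rightarrow> real mat" where
  "lin_comb nr nc c M = mat nr nc (\<lambda>(r, s). \<Sum>k<dim_vec c. c $ k * M k $$ (r, s))"

definition monomial :: "nat \<Rightarrow> (nat \<Rightarrow> nat) \<Rightarrow> real vec \<Rightarrow> real" where
  "monomial n \<alpha> x = (\<Prod>j<n. x $ j ^ \<alpha> j)"

text \<open>Real polynomials are identified with the functions that they induce.\<close>
definition polynomial_map :: "nat \<Rightarrow> nat \<Rightarrow> (real vec \<Rightarrow> real vec) \<Rightarrow> bool" where
  "polynomial_map n k f \<longleftrightarrow>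
     (\<forall>x \<in> carrier_vec n. f x \<in> carrier_vec k) \<and>
     (\<forall>i<k. \<exists>(S :: (nat \<Rightarrow> nat) set) c. finite S \<and>
        (\<forall>x \<in> carrier_vec n. f x $ i = (\<Sum>\<alpha>\<in>S. c \<alpha> * monomial n \<alpha> x)))"

text \<open>The $k \times n$ matrix of partial derivatives at \<open>x\<close>.\<close>
definition jacobian :: "nat \<Rightarrow> nat \<Rightarrow> (real vec \<Rightarrow> real vec) \<Rightarrow> real vec \<Rightarrow> real mat" where
  "jacobian k n f x = mat k n (\<lambda>(i, j).
     THE D. ((\<lambda>t. f (vec n (\<lambda>l. if l = j then t else x $ l)) $ i) has_real_derivative D)
       (at (x $ j)))"

text \<open>\<open>\<alpha> i\<close> is the exponent of the monomial $g_i$.\<close>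
definition lift_map :: "nat \<Rightarrow> nat \<Rightarrow> (nat \<Rightarrow> nat \<Rightarrow> nat) \<Rightarrow> real vec \<Rightarrow> real vec" where
  "lift_map n m \<alpha> x = x @\<^sub>v vec m (\<lambda>i. monomial n (\<alpha> i) x)"

text \<open>\<open>a i\<close> and \<open>b i\<close> are the positions in $w = (x,y)$ of the two factors of $g_i$; the bound
  $n + i$ admits exactly the $x_j$ and the $y_j$ with $j < i$.\<close>
definition inner_quadratic_lift ::
  "nat \<Rightarrow> nat \<Rightarrow> (nat \<Rightarrow> nat \<Rightarrow> nat) \<Rightarrow> (nat \<Rightarrow> nat) \<Rightarrow> (nat \<Rightarrow> nat) \<Rightarrow> bool" where
  "inner_quadratic_lift n m \<alpha> a b \<longleftrightarrow>
     (\<forall>i<m. 2 \<le> (\<Sum>j<n. \<alpha> i j) \<and> a i < n + i \<and> b i < n + i \<and>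
        (\<forall>x \<in> carrier_vec n.
           monomial n (\<alpha> i) x = lift_map n m \<alpha> x $ a i * lift_map n m \<alpha> x $ b i))"

definition reference_extension ::
  "nat \<Rightarrow> nat \<Rightarrow> (real vec \<Rightarrow> real vec) \<Rightarrow> (nat \<Rightarrow> nat \<Rightarrow> nat) \<Rightarrow> real mat \<Rightarrow> real mat \<Rightarrow> bool" where
  "reference_extension n m p \<alpha> A0 H0 \<longleftrightarrow>
     A0 \<in> carrier_mat (n + m) (n + m) \<and> H0 \<in> carrier_mat (n + m) ((n + m) * (n + m)) \<and>
     (\<forall>x \<in> carrier_vec n.
        let w = lift_map n m \<alpha> x in
        A0 *\<^sub>v w + H0 *\<^sub>v kron_vec w w = jacobian (n + m) n (lift_map n m \<alpha>) x *\<^sub>v p x)"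

definition A_stab :: "nat \<Rightarrow> nat \<Rightarrow> real mat \<Rightarrow> real vec \<Rightarrow> real mat" where
  "A_stab n m A0 \<Lambda> = A0 - lin_comb (n + m) (n + m) \<Lambda>
     (\<lambda>i. outer (unit_vec (n + m) (n + i)) (unit_vec (n + m) (n + i)))"

definition H_stab :: "nat \<Rightarrow> nat \<Rightarrow> (nat \<Rightarrow> real vec) \<Rightarrow> real mat \<Rightarrow> real vec \<Rightarrow> real mat" where
  "H_stab n m s H0 \<Lambda> = H0 + lin_comb (n + m) ((n + m) * (n + m)) \<Lambda>
     (\<lambda>i. outer (unit_vec (n + m) (n + i)) (s i))"

definition stable_set :: "nat \<Rightarrow> nat \<Rightarrow> real mat \<Rightarrow> real vec set" where
  "stable_set n m A0 = {\<Lambda> \<in> carrier_vec m. hurwitz (A_stab n m A0 \<Lambda>)}"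

definition gauge_space :: "nat \<Rightarrow> real mat set" where
  "gauge_space N = {K \<in> carrier_mat N (N * N). \<forall>w \<in> carrier_vec N. K *\<^sub>v kron_vec w w = 0\<^sub>v N}"

definition gauge_basis :: "nat \<Rightarrow> nat \<Rightarrow> (nat \<Rightarrow> real mat) \<Rightarrow> bool" where
  "gauge_basis N d K \<longleftrightarrow>
     (\<forall>k<d. K k \<in> gauge_space N) \<and>
     (\<forall>\<mu> \<in> carrier_vec d. lin_comb N (N * N) \<mu> K = 0\<^sub>m N (N * N) \<longrightarrow> \<mu> = 0\<^sub>v d) \<and>
     (\<forall>X \<in> gauge_space N. \<exists>\<mu> \<in> carrier_vec d. X = lin_comb N (N * N) \<mu> K)"

definition gauge_mat :: "nat \<Rightarrow> (nat \<Rightarrow> real mat) \<Rightarrow> real vec \<Rightarrow> real mat" where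
  "gauge_mat N K \<mu> = lin_comb N (N * N) \<mu> K"

definition slice :: "nat \<Rightarrow> real mat \<Rightarrow> nat \<Rightarrow> real mat" where
  "slice N H i = mat N N (\<lambda>(r, j). H $$ (r, i * N + j))"

text \<open>For Hurwitz \<open>A\<close> there is exactly one such \<open>P\<close>.\<close>
definition lyapunov_certificate :: "nat \<Rightarrow> real mat \<Rightarrow> real mat \<Rightarrow> bool" where
  "lyapunov_certificate N A P \<longleftrightarrow>
     P \<in> carrier_mat N N \<and> pd_mat P \<and> transpose_mat A * P + P * A = - 1\<^sub>m N"

definition col_stack :: "nat \<Rightarrow> (nat \<Rightarrow> real mat) \<Rightarrow> real mat" where
  "col_stack N B = mat (N * N) N (\<lambda>(r, c). B (r div N) $$ (r mod N, c))"

definition lyap_stack :: "nat \<Rightarrow> real mat \<Rightarrow> real mat \<Rightarrow> real mat" where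
  "lyap_stack N P H =
     col_stack N (\<lambda>i. transpose_mat (slice N H i) * P + P * slice N H i)"

text \<open>Here and below \<open>H\<close> stands for $H(\Lambda)$ and \<open>P\<close> for $P(\Lambda)$.\<close>
definition G_mat ::
  "nat \<Rightarrow> real mat \<Rightarrow> real mat \<Rightarrow> (nat \<Rightarrow> real mat) \<Rightarrow> real vec \<Rightarrow> real mat" where
  "G_mat N P H K \<mu> = lyap_stack N P (H + gauge_mat N K \<mu>)"

definition J_mat ::
  "nat \<Rightarrow> real mat \<Rightarrow> real mat \<Rightarrow> real mat \<Rightarrow> (nat \<Rightarrow> real mat) \<Rightarrow> real vec \<Rightarrow> real mat" where
  "J_mat N Pf P H K \<mu> =
     the (mat_inverse (kron_mat (transpose_mat Pf) (1\<^sub>m N))) * G_mat N P H K \<mu>"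

definition phi ::
  "nat \<Rightarrow> nat \<Rightarrow> real mat \<Rightarrow> real mat \<Rightarrow> real mat \<Rightarrow> (nat \<Rightarrow> real mat) \<Rightarrow> real" where
  "phi N d Pf P H K = (INF \<mu> \<in> carrier_vec d. spectral_norm (J_mat N Pf P H K \<mu>))"

text \<open>A tuple $(B_i)_{i<N}$ is a function on \<open>nat\<close> of which only the values below \<open>N\<close> matter.\<close>
definition cyclic_space :: "nat \<Rightarrow> (nat \<Rightarrow> real mat) set" where
  "cyclic_space N = {B.
     (\<forall>i<N. B i \<in> carrier_mat N N \<and> symmetric_mat (B i)) \<and>
     (\<forall>i<N. \<forall>j<N. \<forall>k<N. B i $$ (j, k) + B j $$ (k, i) + B k $$ (i, j) = 0)}"

definition cyclic_basis :: "nat \<Rightarrow> nat \<Rightarrow> (nat \<Rightarrow> nat \<Rightarrow> real mat) \<Rightarrow> bool" where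
  "cyclic_basis N q B \<longleftrightarrow>
     (\<forall>l<q. B l \<in> cyclic_space N) \<and>
     (\<forall>\<nu> \<in> carrier_vec q.
        (\<forall>i<N. lin_comb N N \<nu> (\<lambda>l. B l i) = 0\<^sub>m N N) \<longrightarrow> \<nu> = 0\<^sub>v q) \<and>
     (\<forall>X \<in> cyclic_space N. \<exists>\<nu> \<in> carrier_vec q. \<forall>i<N. X i = lin_comb N N \<nu> (\<lambda>l. B l i))"

definition reduced_stack :: "nat \<Rightarrow> (nat \<Rightarrow> nat \<Rightarrow> real mat) \<Rightarrow> real vec \<Rightarrow> real mat" where
  "reduced_stack N B \<nu> = lin_comb (N * N) N \<nu> (\<lambda>l. col_stack N (B l))"

definition Gr_mat ::
  "nat \<Rightarrow> nat \<Rightarrow> real mat \<Rightarrow> real mat \<Rightarrow> (nat \<Rightarrow> real mat) \<Rightarrow> (nat \<Rightarrow> nat \<Rightarrow> real mat) \<Rightarrow>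
     real vec \<Rightarrow> real mat" where
  "Gr_mat N d P H K B \<nu> = G_mat N P H K (0\<^sub>v d) + reduced_stack N B \<nu>"

definition lmi_mat ::
  "nat \<Rightarrow> nat \<Rightarrow> real mat \<Rightarrow> real mat \<Rightarrow> (nat \<Rightarrow> real mat) \<Rightarrow> (nat \<Rightarrow> nat \<Rightarrow> real mat) \<Rightarrow>
     real vec \<Rightarrow> real \<Rightarrow> real mat" where
  "lmi_mat N d P H K B \<nu> \<tau> =
     four_block_mat (kron_mat P (1\<^sub>m N)) (Gr_mat N d P H K B \<nu>)
                    (transpose_mat (Gr_mat N d P H K B \<nu>)) (\<tau> \<cdot>\<^sub>m 1\<^sub>m N)"

definition sdp_feasible ::
  "nat \<Rightarrow> nat \<Rightarrow> nat \<Rightarrow> real mat \<Rightarrow> real mat \<Rightarrow> (nat \<Rightarrow> real mat) \<Rightarrow> (nat \<Rightarrow> nat \<Rightarrow> real mat) \<Rightarrow>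
     real vec \<times> real \<Rightarrow> bool" where
  "sdp_feasible N d q P H K B = (\<lambda>(\<nu>, \<tau>). \<nu> \<in> carrier_vec q \<and> psd_mat (lmi_mat N d P H K B \<nu> \<tau>))"

definition tau_star ::
  "nat \<Rightarrow> nat \<Rightarrow> nat \<Rightarrow> real mat \<Rightarrow> real mat \<Rightarrow> (nat \<Rightarrow> real mat) \<Rightarrow> (nat \<Rightarrow> nat \<Rightarrow> real mat) \<Rightarrow> real" where
  "tau_star N d q P H K B = Inf (snd ` {z. sdp_feasible N d q P H K B z})"

definition sdp_optimal ::
  "nat \<Rightarrow> nat \<Rightarrow> nat \<Rightarrow> real mat \<Rightarrow> real mat \<Rightarrow> (nat \<Rightarrow> real mat) \<Rightarrow> (nat \<Rightarrow> nat \<Rightarrow> real mat) \<Rightarrow>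
     real vec \<Rightarrow> real \<Rightarrow> bool" where
  "sdp_optimal N d q P H K B \<nu> \<tau> \<longleftrightarrow> is_arg_min snd (sdp_feasible N d q P H K B) (\<nu>, \<tau>)"

definition min_norm_gauge ::
  "nat \<Rightarrow> nat \<Rightarrow> real mat \<Rightarrow> (nat \<Rightarrow> real mat) \<Rightarrow> (nat \<Rightarrow> nat \<Rightarrow> real mat) \<Rightarrow>
     real vec \<Rightarrow> real vec \<Rightarrow> bool" where
  "min_norm_gauge N d P K B \<nu> \<mu> \<longleftrightarrow>
     is_arg_min (\<lambda>\<mu>. 1 / 2 * (euclid_norm \<mu>)\<^sup>2)
       (\<lambda>\<mu>. \<mu> \<in> carrier_vec d \<and> lyap_stack N P (gauge_mat N K \<mu>) = reduced_stack N B \<nu>) \<mu>"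

end

theory Submission
  imports Defs
begin

text \<open>Both sides of the identity come from minimizing one norm over one closed set of matrices.

  Let $Q = P_f^{\top} \otimes I_N$, which is invertible because $P = P_f^{\top} P_f$ is positive definite
  (\<open>kron_factor_inverse\<close>). A gauge parameter $\mu$ enters $J(\Lambda,\mu) = Q^{-1} G(\Lambda,\mu)$ only
  through the stack of the matrices $S_i^{\top} P + P S_i$. The slices of a gauge matrix are skew in the
  two indices of the quadratic term, and this makes the tuple $B_i = S_i^{\top} P + P S_i$ cyclic; conversely
  $P S_i = T_i$ with $(T_i)_{jk} = ((B_i)_{jk} - (B_k)_{ji})/3$ recovers gauge slices from any cyclic tuple
  (\<open>lyap_gauge_cyclic\<close>, \<open>cyclic_lyap_gauge\<close>). Hence $\mu$ and $\nu$ parametrize the same set of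
  stacks $Y$, and $\phi(\Lambda)$ is the infimum of $\|Q^{-1}(G(\Lambda,0) + Y)\|$ over this set.

  On the other side, $Q Q^{\top} = P \otimes I_N$ is the upper left block of the matrix inequality and
  $G_{\rm r} = Q (Q^{-1} G_{\rm r})$ is its upper right block. Completing the square
  (\<open>schur_quadratic_form\<close>) shows that the inequality holds exactly if $\|Q^{-1} G_{\rm r}\|^2 \le \tau$,
  and that it is strict if the bound is strict. Therefore $\tau^\star$ is the square of the same
  minimum, and an optimal $\nu$ is one whose stack minimizes the norm.

  The minimum is attained by compactness: the spectral norm dominates the entries of a matrix, and
  cyclic stacks are cut out by linear equations between entries, so that a minimizing sequence has a
  subsequence converging to a minimizer (\<open>whitened_norm_attains_minimum\<close>).

  Finally, the linear problem for $\mu^\star$ is consistent because every cyclic stack comes from a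
  gauge matrix, and strict convexity gives a unique solution of least norm
  (\<open>minimum_norm_solution_exists_unique\<close>). It has the stack of $\nu^\star$, hence the same norm, and
  gauge matrices do not change the quadratic vector field.\<close>

section \<open>Attainment of minima in finitely many coordinates\<close>

text \<open>The Bolzano--Weierstrass theorem, one coordinate at a time. Convergence of matrices and vectors
  means convergence of their entries throughout; here the entries of the \<open>k\<close>-th member of a
  sequence are the values of \<open>f k\<close> on \<open>I\<close>.\<close>
lemma convergent_subsequence_coordinates:
  fixes f :: "nat \<Rightarrow> 'i \<Rightarrow> real"
  assumes "finite I" "\<And>k i. i \<in> I \<Longrightarrow> \<bar>f k i\<bar> \<le> c"
  shows "\<exists>r l. strict_mono (r :: nat \<Rightarrow> nat) \<and> (\<forall>i\<in>I. (\<lambda>k. f (r k) i) \<longlonglongrightarrow> l i)"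
  using assms
proof (induction I rule: finite_induct)
  case empty
  show ?case by (intro exI[of _ id]) (auto simp: strict_mono_def)
next
  case (insert i I)
  have "\<exists>r l. strict_mono (r :: nat \<Rightarrow> nat) \<and> (\<forall>i\<in>I. (\<lambda>k. f (r k) i) \<longlonglongrightarrow> l i)"
    using insert.prems by (intro insert.IH) auto
  then obtain r l where r: "strict_mono r" and l: "\<forall>j\<in>I. (\<lambda>k. f (r k) j) \<longlonglongrightarrow> l j"
    by blast
  obtain g :: "nat \<Rightarrow> nat" where g: "strict_mono g" "monoseq (\<lambda>k. f (r (g k)) i)"
    using seq_monosub[of "\<lambda>k. f (r k) i"] by auto
  have "Bseq (\<lambda>k. f (r (g k)) i)"
    using insert.prems by (intro BseqI'[of _ c]) auto
  then obtain a where a: "(\<lambda>k. f (r (g k)) i) \<longlonglongrightarrow> a"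
    using Bseq_monoseq_convergent g(2) convergent_def by blast
  have "(\<lambda>k. f (r (g k)) j) \<longlonglongrightarrow> l j" if "j \<in> I" for j
    using LIMSEQ_subseq_LIMSEQ[OF l[rule_format, OF that] g(1)] by (simp add: o_def)
  then have "\<forall>j\<in>insert i I. (\<lambda>k. f ((r \<circ> g) k) j) \<longlonglongrightarrow> (l(i := a)) j"
    using a insert.hyps by auto
  moreover have "strict_mono (r \<circ> g)"
    using r g(1) by (rule strict_mono_o)
  ultimately show ?case by blast
qed

text \<open>The direct method. A minimizing sequence has bounded coordinates, because \<open>f\<close> dominates them;
  a subsequence then converges in every coordinate. The last hypothesis joins closedness of \<open>S\<close>
  and lower semicontinuity of \<open>f\<close>: it only asks for some point of \<open>S\<close> that is no worse than the
  limit of the values.\<close>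
lemma minimum_attained_if_coercive:
  fixes f :: "'x \<Rightarrow> real" and e :: "'x \<Rightarrow> 'i \<Rightarrow> real"
  assumes I: "finite I" and S: "S \<noteq> {}"
    and nonneg: "\<And>x. x \<in> S \<Longrightarrow> 0 \<le> f x"
    and coercive: "\<And>x i. x \<in> S \<Longrightarrow> i \<in> I \<Longrightarrow> \<bar>e x i\<bar> \<le> f x"
    and lsc: "\<And>X l t. (\<And>k. X k \<in> S) \<Longrightarrow> (\<And>i. i \<in> I \<Longrightarrow> (\<lambda>k. e (X k) i) \<longlonglongrightarrow> l i) \<Longrightarrow>
       (\<lambda>k. f (X k)) \<longlonglongrightarrow> t \<Longrightarrow> \<exists>x\<in>S. f x \<le> t"
  shows "\<exists>x\<in>S. \<forall>y\<in>S. f x \<le> f y"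
proof -
  define t where "t = (INF x\<in>S. f x)"
  have bdd: "bdd_below (f ` S)" using nonneg by (auto intro!: bdd_belowI2)
  have t: "t \<le> f y" if "y \<in> S" for y
    unfolding t_def using bdd that by (rule cINF_lower)
  have "\<exists>x\<in>S. f x < t + 1 / real (Suc k)" for k
    using cINF_less_iff[OF S bdd, of "t + 1 / real (Suc k)"] unfolding t_def by simp
  then obtain X where X: "\<And>k. X k \<in> S" "\<And>k. f (X k) < t + 1 / real (Suc k)"
    by metis
  have lim: "(\<lambda>k. f (X k)) \<longlonglongrightarrow> t"
  proof (rule tendsto_sandwich)
    show "(\<lambda>k. t) \<longlonglongrightarrow> t" by simp
    show "(\<lambda>k. t + 1 / real (Suc k)) \<longlonglongrightarrow> t"
      using tendsto_add[OF tendsto_const LIMSEQ_inverse_real_of_nat, of t]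
      by (simp add: inverse_eq_divide)
  qed (use X t in \<open>auto simp: less_imp_le\<close>)
  have "\<bar>e (X k) i\<bar> \<le> t + 1" if "i \<in> I" for k i
  proof -
    have "1 / real (Suc k) \<le> 1" by simp
    then show ?thesis using coercive[OF X(1) that, of k] X(2)[of k] by linarith
  qed
  then obtain r l where r: "strict_mono (r :: nat \<Rightarrow> nat)"
    and l: "\<forall>i\<in>I. (\<lambda>k. e (X (r k)) i) \<longlonglongrightarrow> l i"
    using convergent_subsequence_coordinates[OF I, of "\<lambda>k. e (X k)" "t + 1"] by blast
  have "(\<lambda>k. f (X (r k))) \<longlonglongrightarrow> t"
    using LIMSEQ_subseq_LIMSEQ[OF lim r] by (simp add: o_def)
  then obtain x where "x \<in> S" "f x \<le> t"
    using lsc[of "\<lambda>k. X (r k)" l t] X(1) l by auto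
  then show ?thesis using t by force
qed

section \<open>The Euclidean and the spectral norm\<close>
lemma scalar_prod_self_sum:
  fixes v :: "real vec"
  shows "v \<bullet> v = (\<Sum>i<dim_vec v. (v $ i)\<^sup>2)"
  by (simp add: scalar_prod_def power2_eq_square atLeast0LessThan)

lemma scalar_prod_self_nonneg: "0 \<le> (v :: real vec) \<bullet> v"
  by (simp add: scalar_prod_self_sum sum_nonneg)

lemma scalar_prod_self_pos:
  fixes v :: "real vec"
  assumes "v \<in> carrier_vec n" "v \<noteq> 0\<^sub>v n"
  shows "0 < v \<bullet> v"
proof -
  from assms obtain i where "i < n" "v $ i \<noteq> 0" by (auto simp: vec_eq_iff)
  then show ?thesis
    using assms by (auto simp: scalar_prod_self_sum intro!: sum_pos2[of _ i])
qed

lemma euclid_norm_nonneg: "0 \<le> euclid_norm v"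
  by (simp add: euclid_norm_def scalar_prod_self_nonneg)

lemma euclid_norm_power2: "(euclid_norm v)\<^sup>2 = v \<bullet> v"
  by (simp add: euclid_norm_def scalar_prod_self_nonneg)

lemma abs_index_le_euclid_norm:
  assumes "i < dim_vec v"
  shows "\<bar>v $ i\<bar> \<le> euclid_norm v"
proof -
  have "(v $ i)\<^sup>2 \<le> v \<bullet> v"
    unfolding scalar_prod_self_sum using assms by (intro member_le_sum) auto
  then show ?thesis unfolding euclid_norm_def by (metis real_sqrt_abs real_sqrt_le_iff)
qed

lemma euclid_norm_smult: "euclid_norm (c \<cdot>\<^sub>v v) = \<bar>c\<bar> * euclid_norm v"
proof -
  have "(c \<cdot>\<^sub>v v) \<bullet> (c \<cdot>\<^sub>v v) = c\<^sup>2 * (v \<bullet> v)"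
    by (simp add: power2_eq_square)
  then show ?thesis by (simp add: euclid_norm_def real_sqrt_mult)
qed

lemma mult_mat_vec_index_sum:
  assumes "M \<in> carrier_mat nr nc" "v \<in> carrier_vec nc" "i < nr"
  shows "(M *\<^sub>v v) $ i = (\<Sum>j<nc. M $$ (i, j) * v $ j)"
  using assms by (auto simp: scalar_prod_def atLeast0LessThan)

lemma mult_mat_index_sum:
  assumes "M \<in> carrier_mat nr n" "M' \<in> carrier_mat n nc" "i < nr" "j < nc"
  shows "(M * M') $$ (i, j) = (\<Sum>l<n. M $$ (i, l) * M' $$ (l, j))"
  using assms by (auto simp: scalar_prod_def atLeast0LessThan)

text \<open>This makes the supremum in the spectral norm meaningful: on the unit ball the \<open>i\<close>-th entry of
  \<open>M *\<^sub>v v\<close> is at most the sum of the absolute values in row \<open>i\<close>.\<close>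
lemma euclid_norm_mult_bounded:
  "bdd_above ((\<lambda>v. euclid_norm (M *\<^sub>v v)) ` {v \<in> carrier_vec (dim_col M). euclid_norm v \<le> 1})"
proof (rule bdd_aboveI2)
  fix v assume v: "v \<in> {v \<in> carrier_vec (dim_col M). euclid_norm v \<le> 1}"
  have "\<bar>(M *\<^sub>v v) $ i\<bar> \<le> (\<Sum>j<dim_col M. \<bar>M $$ (i, j)\<bar>)" if i: "i < dim_row M" for i
  proof -
    have "\<bar>M $$ (i, j) * v $ j\<bar> \<le> \<bar>M $$ (i, j)\<bar>" if "j < dim_col M" for j
      using abs_index_le_euclid_norm[of j v] v that by (auto simp: abs_mult mult_left_le)
    then show ?thesis
      using v
      by (subst mult_mat_vec_index_sum[of M "dim_row M" "dim_col M"])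
        (auto simp: i intro!: order_trans[OF sum_abs] sum_mono)
  qed
  then have "((M *\<^sub>v v) $ i)\<^sup>2 \<le> (\<Sum>j<dim_col M. \<bar>M $$ (i, j)\<bar>)\<^sup>2" if "i < dim_row M" for i
    using that by (simp add: abs_le_square_iff[symmetric] sum_nonneg)
  then show "euclid_norm (M *\<^sub>v v) \<le> sqrt (\<Sum>i<dim_row M. (\<Sum>j<dim_col M. \<bar>M $$ (i, j)\<bar>)\<^sup>2)"
    unfolding euclid_norm_def scalar_prod_self_sum by (auto intro!: sum_mono)
qed

lemma euclid_norm_mult_le:
  assumes "v \<in> carrier_vec (dim_col M)"
  shows "euclid_norm (M *\<^sub>v v) \<le> spectral_norm M * euclid_norm v"
proof (cases "v = 0\<^sub>v (dim_col M)")
  case True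
  have "M *\<^sub>v 0\<^sub>v (dim_col M) = 0\<^sub>v (dim_row M)" by (intro eq_vecI) auto
  then show ?thesis by (simp add: True euclid_norm_def)
next
  case False
  define c where "c = euclid_norm v"
  have c: "0 < c"
    unfolding c_def euclid_norm_def using scalar_prod_self_pos[OF assms False] by simp
  have "euclid_norm (M *\<^sub>v (inverse c \<cdot>\<^sub>v v)) \<le> spectral_norm M"
    unfolding spectral_norm_def
    by (rule cSUP_upper[OF _ euclid_norm_mult_bounded])
      (use assms c in \<open>auto simp: euclid_norm_smult c_def[symmetric]\<close>)
  moreover have "M *\<^sub>v (inverse c \<cdot>\<^sub>v v) = inverse c \<cdot>\<^sub>v (M *\<^sub>v v)"
    using assms by (intro mult_mat_vec[of _ "dim_row M" "dim_col M"]) auto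
  ultimately show ?thesis
    using c by (simp add: euclid_norm_smult c_def[symmetric] field_simps)
qed

lemma spectral_norm_least:
  assumes "0 \<le> t" "\<And>v. v \<in> carrier_vec (dim_col M) \<Longrightarrow> euclid_norm (M *\<^sub>v v) \<le> t * euclid_norm v"
  shows "spectral_norm M \<le> t"
  unfolding spectral_norm_def
proof (rule cSUP_least)
  have "0\<^sub>v (dim_col M) \<in> {v \<in> carrier_vec (dim_col M). euclid_norm v \<le> 1}"
    by (simp add: euclid_norm_def)
  then show "{v \<in> carrier_vec (dim_col M). euclid_norm v \<le> 1} \<noteq> {}" by blast
next
  fix v assume "v \<in> {v \<in> carrier_vec (dim_col M). euclid_norm v \<le> 1}"
  then show "euclid_norm (M *\<^sub>v v) \<le> t"
    using assms(2)[of v] mult_left_le[of "euclid_norm v" t] assms(1) by force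
qed

lemma spectral_norm_nonneg: "0 \<le> spectral_norm M"
proof -
  have "euclid_norm (M *\<^sub>v 0\<^sub>v (dim_col M)) \<le> spectral_norm M"
    unfolding spectral_norm_def
    by (rule cSUP_upper[OF _ euclid_norm_mult_bounded]) (simp add: euclid_norm_def)
  then show ?thesis using euclid_norm_nonneg order_trans by blast
qed

text \<open>The coercivity of the spectral norm that the direct method needs: column \<open>j\<close> is the image of a
  unit vector.\<close>
lemma abs_index_le_spectral_norm:
  assumes "i < dim_row M" "j < dim_col M"
  shows "\<bar>M $$ (i, j)\<bar> \<le> spectral_norm M"
proof -
  have "M *\<^sub>v unit_vec (dim_col M) j = col M j"
    using assms by (intro eq_vecI) auto
  moreover have "euclid_norm (unit_vec (dim_col M) j) = 1"
    using assms by (simp add: euclid_norm_def)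
  ultimately have "euclid_norm (col M j) \<le> spectral_norm M"
    using euclid_norm_mult_le[of "unit_vec (dim_col M) j" M] by simp
  then show ?thesis
    using abs_index_le_euclid_norm[of i "col M j"] assms by simp
qed

text \<open>The form in which a bound on the spectral norm meets semidefiniteness. With no columns the
  right-hand side would hold even for negative \<open>t\<close>.\<close>
lemma spectral_norm_power2_le_iff:
  assumes "0 < dim_col M"
  shows "(spectral_norm M)\<^sup>2 \<le> t \<longleftrightarrow>
    (\<forall>v \<in> carrier_vec (dim_col M). (M *\<^sub>v v) \<bullet> (M *\<^sub>v v) \<le> t * (v \<bullet> v))"
proof
  assume t: "(spectral_norm M)\<^sup>2 \<le> t"
  show "\<forall>v \<in> carrier_vec (dim_col M). (M *\<^sub>v v) \<bullet> (M *\<^sub>v v) \<le> t * (v \<bullet> v)"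
  proof
    fix v :: "real vec" assume "v \<in> carrier_vec (dim_col M)"
    then have "(euclid_norm (M *\<^sub>v v))\<^sup>2 \<le> (spectral_norm M * euclid_norm v)\<^sup>2"
      by (intro power_mono euclid_norm_mult_le euclid_norm_nonneg)
    also have "\<dots> \<le> t * (euclid_norm v)\<^sup>2"
      using t by (simp add: power_mult_distrib mult_right_mono)
    finally show "(M *\<^sub>v v) \<bullet> (M *\<^sub>v v) \<le> t * (v \<bullet> v)" by (simp add: euclid_norm_power2)
  qed
next
  assume bound: "\<forall>v \<in> carrier_vec (dim_col M). (M *\<^sub>v v) \<bullet> (M *\<^sub>v v) \<le> t * (v \<bullet> v)"
  have "(M *\<^sub>v unit_vec (dim_col M) 0) \<bullet> (M *\<^sub>v unit_vec (dim_col M) 0) \<le> t"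
    using bound[rule_format, of "unit_vec (dim_col M) 0"] assms by simp
  then have t: "0 \<le> t" using scalar_prod_self_nonneg order_trans by blast
  have "spectral_norm M \<le> sqrt t"
  proof (rule spectral_norm_least)
    fix v :: "real vec" assume "v \<in> carrier_vec (dim_col M)"
    then show "euclid_norm (M *\<^sub>v v) \<le> sqrt t * euclid_norm v"
      using bound unfolding euclid_norm_def by (simp add: real_sqrt_mult[symmetric])
  qed (use t in simp)
  then have "(spectral_norm M)\<^sup>2 \<le> (sqrt t)\<^sup>2"
    by (intro power_mono spectral_norm_nonneg)
  then show "(spectral_norm M)\<^sup>2 \<le> t" using t by simp
qed

text \<open>For a fixed vector \<open>v\<close> the norm of \<open>X k *\<^sub>v v\<close> depends continuously on the entries, so the bound
  that defines the spectral norm passes to the limit.\<close>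
lemma spectral_norm_lsc:
  assumes X: "\<And>k. X k \<in> carrier_mat nr nc" and M: "M \<in> carrier_mat nr nc"
    and lim: "\<And>i j. i < nr \<Longrightarrow> j < nc \<Longrightarrow> (\<lambda>k. X k $$ (i, j)) \<longlonglongrightarrow> M $$ (i, j)"
    and t: "(\<lambda>k. spectral_norm (X k)) \<longlonglongrightarrow> t"
  shows "spectral_norm M \<le> t"
proof (rule spectral_norm_least)
  show "0 \<le> t" using t by (rule LIMSEQ_le_const) (simp add: spectral_norm_nonneg)
  fix v :: "real vec" assume "v \<in> carrier_vec (dim_col M)"
  then have v: "v \<in> carrier_vec nc" using M by simp
  have norm_eq: "euclid_norm (Y *\<^sub>v v) = sqrt (\<Sum>i<nr. (\<Sum>j<nc. Y $$ (i, j) * v $ j)\<^sup>2)"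
    if Y: "Y \<in> carrier_mat nr nc" for Y
    using Y v unfolding euclid_norm_def scalar_prod_self_sum
    by (auto simp del: index_mult_mat_vec intro!: sum.cong
        simp: mult_mat_vec_index_sum[OF Y v])
  have "(\<lambda>k. euclid_norm (X k *\<^sub>v v)) \<longlonglongrightarrow> euclid_norm (M *\<^sub>v v)"
    unfolding norm_eq[OF X] norm_eq[OF M] by (intro tendsto_intros lim) auto
  moreover have "(\<lambda>k. spectral_norm (X k) * euclid_norm v) \<longlonglongrightarrow> t * euclid_norm v"
    by (intro tendsto_intros t)
  ultimately show "euclid_norm (M *\<^sub>v v) \<le> t * euclid_norm v"
    by (rule LIMSEQ_le) (use carrier_matD(2)[OF X] v in \<open>auto intro!: exI[of _ 0] euclid_norm_mult_le\<close>)
qed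

lemma spectral_norm_attains_minimum:
  assumes S: "S \<subseteq> carrier_mat nr nc" "S \<noteq> {}"
    and closed: "\<And>X M. (\<And>k. X k \<in> S) \<Longrightarrow> M \<in> carrier_mat nr nc \<Longrightarrow>
       (\<And>i j. i < nr \<Longrightarrow> j < nc \<Longrightarrow> (\<lambda>k. X k $$ (i, j)) \<longlonglongrightarrow> M $$ (i, j)) \<Longrightarrow> M \<in> S"
  shows "\<exists>M\<in>S. \<forall>M'\<in>S. spectral_norm M \<le> spectral_norm M'"
proof (rule minimum_attained_if_coercive[where e = "\<lambda>M ij. M $$ ij" and I = "{..<nr} \<times> {..<nc}"])
  fix X l t
  assume X: "\<And>k. X k \<in> S"
    and lim: "\<And>ij. ij \<in> {..<nr} \<times> {..<nc} \<Longrightarrow> (\<lambda>k. X k $$ ij) \<longlonglongrightarrow> l ij"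
    and t: "(\<lambda>k. spectral_norm (X k)) \<longlonglongrightarrow> t"
  define M where "M = mat nr nc l"
  have M: "M \<in> carrier_mat nr nc" by (simp add: M_def)
  have entry: "(\<lambda>k. X k $$ (i, j)) \<longlonglongrightarrow> M $$ (i, j)" if "i < nr" "j < nc" for i j
    using lim[of "(i, j)"] that by (simp add: M_def)
  have "M \<in> S" using closed[of X M] X M entry by blast
  moreover have "spectral_norm M \<le> t"
    by (rule spectral_norm_lsc[of X nr nc]) (use X S M entry t in auto)
  ultimately show "\<exists>M\<in>S. spectral_norm M \<le> t" by blast
qed (use S in \<open>auto simp: spectral_norm_nonneg intro!: abs_index_le_spectral_norm\<close>)

section \<open>Solutions of minimum norm\<close>
lemma dim_lin_comb [simp]:
  "dim_row (lin_comb nr nc c M) = nr" "dim_col (lin_comb nr nc c M) = nc"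
  by (simp_all add: lin_comb_def)

lemma lin_comb_carrier [simp]: "lin_comb nr nc c M \<in> carrier_mat nr nc"
  by (simp add: lin_comb_def)

lemma lin_comb_index:
  assumes "r < nr" "s < nc"
  shows "lin_comb nr nc c M $$ (r, s) = (\<Sum>k<dim_vec c. c $ k * M k $$ (r, s))"
  using assms by (simp add: lin_comb_def)

lemma lin_comb_zero: "lin_comb nr nc (0\<^sub>v d) M = 0\<^sub>m nr nc"
  by (rule eq_matI) (simp_all add: lin_comb_index)

lemma lin_comb_add_smult:
  assumes "u \<in> carrier_vec d" "v \<in> carrier_vec d"
  shows "lin_comb nr nc (u + c \<cdot>\<^sub>v v) M = lin_comb nr nc u M + c \<cdot>\<^sub>m lin_comb nr nc v M"
  by (rule eq_matI)
    (use assms in \<open>auto simp: lin_comb_index sum.distrib sum_distrib_left algebra_simps\<close>)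

text \<open>The solutions of a linear system form a closed affine space, on which the squared norm is coercive and
  strictly convex. Existence is the direct method. For uniqueness, if two solutions have the same
  least norm and differ by \<open>\<delta>\<close>, their midpoint is again a solution, and the norm is smaller there
  unless \<open>\<delta>\<close> vanishes.\<close>
lemma minimum_norm_solution_exists_unique:
  assumes feasible: "\<mu>0 \<in> carrier_vec d" "lin_comb nr nc \<mu>0 M = T"
  shows "\<exists>!\<mu>. is_arg_min (\<lambda>\<mu>. 1 / 2 * (euclid_norm \<mu>)\<^sup>2)
    (\<lambda>\<mu>. \<mu> \<in> carrier_vec d \<and> lin_comb nr nc \<mu> M = T) \<mu>"
proof -
  define S where "S = {\<mu> \<in> carrier_vec d. lin_comb nr nc \<mu> M = T}"
  have min_iff: "is_arg_min (\<lambda>\<mu>. 1 / 2 * (euclid_norm \<mu>)\<^sup>2)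
      (\<lambda>\<mu>. \<mu> \<in> carrier_vec d \<and> lin_comb nr nc \<mu> M = T) \<mu> \<longleftrightarrow>
    \<mu> \<in> S \<and> (\<forall>\<mu>'\<in>S. \<mu> \<bullet> \<mu> \<le> \<mu>' \<bullet> \<mu>')" for \<mu>
    by (auto simp: is_arg_min_linorder S_def euclid_norm_power2)
  have "\<exists>\<mu>\<in>S. \<forall>\<mu>'\<in>S. euclid_norm \<mu> \<le> euclid_norm \<mu>'"
  proof (rule minimum_attained_if_coercive[where e = "\<lambda>\<mu> i. \<mu> $ i" and I = "{..<d}"])
    fix X l t
    assume X: "\<And>k. X k \<in> S"
      and lim: "\<And>i. i \<in> {..<d} \<Longrightarrow> (\<lambda>k. X k $ i) \<longlonglongrightarrow> l i"
      and t: "(\<lambda>k. euclid_norm (X k)) \<longlonglongrightarrow> t"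
    have dimX: "dim_vec (X k) = d" for k using X[of k] by (simp add: S_def)
    have TX: "lin_comb nr nc (X k) M = T" for k using X[of k] by (simp add: S_def)
    have "lin_comb nr nc (vec d l) M = T"
    proof (rule eq_matI)
      fix i j assume "i < dim_row T" "j < dim_col T"
      then have ij: "i < nr" "j < nc" using feasible(2) by auto
      have "(\<lambda>k. \<Sum>s<d. X k $ s * M s $$ (i, j)) \<longlonglongrightarrow> (\<Sum>s<d. l s * M s $$ (i, j))"
        by (intro tendsto_intros lim) auto
      moreover have "(\<Sum>s<d. X k $ s * M s $$ (i, j)) = T $$ (i, j)" for k
        using TX[of k] lin_comb_index[OF ij, of "X k" M] dimX by simp
      ultimately have "(\<Sum>s<d. l s * M s $$ (i, j)) = T $$ (i, j)"
        by (simp add: LIMSEQ_const_iff)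
      then show "lin_comb nr nc (vec d l) M $$ (i, j) = T $$ (i, j)"
        by (simp add: lin_comb_index[OF ij])
    qed (use feasible(2) in auto)
    then have "vec d l \<in> S" by (simp add: S_def)
    moreover have "(\<lambda>k. sqrt (\<Sum>i<d. (X k $ i)\<^sup>2)) \<longlonglongrightarrow> sqrt (\<Sum>i<d. (l i)\<^sup>2)"
      by (intro tendsto_intros lim) auto
    then have "euclid_norm (vec d l) = t"
      using LIMSEQ_unique[OF t]
      by (simp add: euclid_norm_def scalar_prod_self_sum dimX)
    ultimately show "\<exists>\<mu>\<in>S. euclid_norm \<mu> \<le> t" by blast
  qed (use feasible in \<open>auto simp: S_def euclid_norm_nonneg intro!: abs_index_le_euclid_norm\<close>)
  then obtain \<mu> where \<mu>: "\<mu> \<in> S" "\<And>\<mu>'. \<mu>' \<in> S \<Longrightarrow> \<mu> \<bullet> \<mu> \<le> \<mu>' \<bullet> \<mu>'"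
    by (auto simp: euclid_norm_def)
  show ?thesis
    unfolding min_iff
  proof (rule ex1I[of _ \<mu>])
    fix \<rho> assume \<rho>: "\<rho> \<in> S \<and> (\<forall>\<mu>'\<in>S. \<rho> \<bullet> \<rho> \<le> \<mu>' \<bullet> \<mu>')"
    have c: "\<mu> \<in> carrier_vec d" "\<rho> \<in> carrier_vec d" using \<mu> \<rho> by (auto simp: S_def)
    define \<delta> where "\<delta> = \<rho> - \<mu>"
    have \<delta>: "\<delta> \<in> carrier_vec d" and \<rho>_eq: "\<rho> = \<mu> + 1 \<cdot>\<^sub>v \<delta>"
      using c by (auto simp: \<delta>_def)
    have T: "lin_comb nr nc \<mu> M = T" "lin_comb nr nc \<rho> M = T" using \<mu> \<rho> by (auto simp: S_def)
    have shift: "T = T + 1 \<cdot>\<^sub>m lin_comb nr nc \<delta> M"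
      using lin_comb_add_smult[OF c(1) \<delta>, of nr nc 1 M] unfolding \<rho>_eq[symmetric] T .
    have "lin_comb nr nc \<delta> M = 0\<^sub>m nr nc"
    proof (rule eq_matI)
      fix i j assume "i < dim_row (0\<^sub>m nr nc :: real mat)" "j < dim_col (0\<^sub>m nr nc :: real mat)"
      then show "lin_comb nr nc \<delta> M $$ (i, j) = 0\<^sub>m nr nc $$ (i, j)"
        using arg_cong[OF shift, of "\<lambda>X. X $$ (i, j)"] by simp
    qed auto
    then have "lin_comb nr nc (\<mu> + (1/2) \<cdot>\<^sub>v \<delta>) M = T"
      using lin_comb_add_smult[OF c(1) \<delta>, of nr nc "1/2" M] T(1) lin_comb_carrier[of nr nc \<mu> M]
      by (auto intro!: eq_matI)
    then have "\<mu> + (1/2) \<cdot>\<^sub>v \<delta> \<in> S" using c \<delta> by (simp add: S_def)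
    then have "\<mu> \<bullet> \<mu> \<le> (\<mu> + (1/2) \<cdot>\<^sub>v \<delta>) \<bullet> (\<mu> + (1/2) \<cdot>\<^sub>v \<delta>)" by (rule \<mu>(2))
    moreover have expand: "(\<mu> + s \<cdot>\<^sub>v \<delta>) \<bullet> (\<mu> + s \<cdot>\<^sub>v \<delta>) = \<mu> \<bullet> \<mu> + 2 * s * (\<mu> \<bullet> \<delta>) + s\<^sup>2 * (\<delta> \<bullet> \<delta>)" for s
      using c \<delta> comm_scalar_prod[OF \<delta> c(1)]
      by (simp add: scalar_prod_add_distrib[of _ d] add_scalar_prod_distrib[of _ d]
          power2_eq_square algebra_simps)
    moreover have "\<rho> \<bullet> \<rho> \<le> \<mu> \<bullet> \<mu>" using \<mu>(1) \<rho> by blast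
    then have "2 * (\<mu> \<bullet> \<delta>) + \<delta> \<bullet> \<delta> \<le> 0" using expand[of 1] unfolding \<rho>_eq[symmetric] by simp
    ultimately have "\<delta> \<bullet> \<delta> \<le> 0" using expand[of "1/2"] by (simp add: power2_eq_square)
    then have "\<delta> = 0\<^sub>v d" using scalar_prod_self_pos[OF \<delta>] by force
    then show "\<rho> = \<mu>" using \<rho>_eq c by auto
  qed (use \<mu> in blast)
qed

section \<open>Kronecker products\<close>
lemma div_mod_split:
  fixes i j n :: nat
  assumes "j < n"
  shows "(i * n + j) div n = i" "(i * n + j) mod n = j"
  using assms by simp_all

lemma mult_add_less:
  fixes i j m n :: nat
  assumes "i < m" "j < n"
  shows "i * n + j < m * n"
proof -
  have "i * n + j < (i + 1) * n" using assms by simp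
  also have "\<dots> \<le> m * n" using assms by (intro mult_right_mono) auto
  finally show ?thesis .
qed

text \<open>An index below \<open>m * n\<close> is a pair of indices; sums over the columns of a Kronecker product or of
  $H$ become double sums.\<close>
lemma sum_div_mod:
  fixes f :: "nat \<Rightarrow> nat \<Rightarrow> 'a :: comm_monoid_add"
  shows "(\<Sum>k<m * n. f (k div n) (k mod n)) = (\<Sum>i<m. \<Sum>j<n. f i j)"
  unfolding sum.cartesian_product
proof (rule sum.reindex_bij_witness[where i = "\<lambda>(i, j). i * n + j" and j = "\<lambda>k. (k div n, k mod n)"])
  fix k assume "k \<in> {..<m * n}"
  then have k: "k < m * n" by simp
  then have "0 < n" by (cases n) auto
  then show "(k div n, k mod n) \<in> {..<m} \<times> {..<n}"
    using k by (simp add: less_mult_imp_div_less)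
qed (auto simp: div_mod_split mult_add_less)

lemma div_mod_less:
  fixes r m n :: nat
  assumes "r < m * n"
  shows "r div n < m" "r mod n < n"
  using assms by (auto simp: less_mult_imp_div_less intro!: mod_less_divisor) (cases n, auto)

lemma dim_kron_mat [simp]:
  "dim_row (kron_mat A B) = dim_row A * dim_row B"
  "dim_col (kron_mat A B) = dim_col A * dim_col B"
  by (simp_all add: kron_mat_def)

lemma kron_mat_index:
  assumes "r < dim_row A * dim_row B" "c < dim_col A * dim_col B"
  shows "kron_mat A B $$ (r, c) =
    A $$ (r div dim_row B, c div dim_col B) * B $$ (r mod dim_row B, c mod dim_col B)"
  using assms by (simp add: kron_mat_def)

lemma kron_mat_mult:
  assumes "dim_col A = dim_row C" "dim_col B = dim_row D"
  shows "kron_mat A B * kron_mat C D = kron_mat (A * C) (B * D)"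
proof (rule eq_matI)
  fix r c assume "r < dim_row (kron_mat (A * C) (B * D))" "c < dim_col (kron_mat (A * C) (B * D))"
  then have r: "r < dim_row A * dim_row B" and c: "c < dim_col C * dim_col D" by simp_all
  note rc = div_mod_less[OF r] div_mod_less[OF c]
  have "(kron_mat A B * kron_mat C D) $$ (r, c) =
    (\<Sum>k<dim_col A * dim_col B. kron_mat A B $$ (r, k) * kron_mat C D $$ (k, c))"
    using r c assms by (intro mult_mat_index_sum) auto
  also have "\<dots> = (\<Sum>k<dim_col A * dim_col B.
      A $$ (r div dim_row B, k div dim_col B) * B $$ (r mod dim_row B, k mod dim_col B) *
      (C $$ (k div dim_col B, c div dim_col D) * D $$ (k mod dim_col B, c mod dim_col D)))"
    using r c assms by (intro sum.cong refl) (simp add: kron_mat_index)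
  also have "\<dots> = (\<Sum>i<dim_col A. \<Sum>j<dim_col B.
      A $$ (r div dim_row B, i) * B $$ (r mod dim_row B, j) *
      (C $$ (i, c div dim_col D) * D $$ (j, c mod dim_col D)))"
    by (rule sum_div_mod)
  also have "\<dots> = (\<Sum>i<dim_col A. A $$ (r div dim_row B, i) * C $$ (i, c div dim_col D)) *
      (\<Sum>j<dim_col B. B $$ (r mod dim_row B, j) * D $$ (j, c mod dim_col D))"
    by (simp add: sum_product algebra_simps)
  also have "\<dots> = (A * C) $$ (r div dim_row B, c div dim_col D) *
      (B * D) $$ (r mod dim_row B, c mod dim_col D)"
    using rc assms
    by (subst (1 2) mult_mat_index_sum) auto
  also have "\<dots> = kron_mat (A * C) (B * D) $$ (r, c)"
    using r c by (simp add: kron_mat_index del: index_mult_mat(1))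
  finally show "(kron_mat A B * kron_mat C D) $$ (r, c) = kron_mat (A * C) (B * D) $$ (r, c)" .
qed simp_all

lemma transpose_kron_mat:
  "transpose_mat (kron_mat A B) = kron_mat (transpose_mat A) (transpose_mat B)"
proof (rule eq_matI)
  fix r c assume "r < dim_row (kron_mat (transpose_mat A) (transpose_mat B))"
    "c < dim_col (kron_mat (transpose_mat A) (transpose_mat B))"
  then have rc: "r < dim_col A * dim_col B" "c < dim_row A * dim_row B" by simp_all
  then show "transpose_mat (kron_mat A B) $$ (r, c) =
      kron_mat (transpose_mat A) (transpose_mat B) $$ (r, c)"
    using div_mod_less[OF rc(1)] div_mod_less[OF rc(2)] by (simp add: kron_mat_index)
qed simp_all

lemma kron_mat_one: "kron_mat (1\<^sub>m m) (1\<^sub>m n) = 1\<^sub>m (m * n)"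
proof (rule eq_matI)
  fix r c assume "r < dim_row (1\<^sub>m (m * n) :: real mat)" "c < dim_col (1\<^sub>m (m * n) :: real mat)"
  then have rc: "r < m * n" "c < m * n" by simp_all
  have "r div n = c div n \<and> r mod n = c mod n \<longleftrightarrow> r = c" by (metis div_mult_mod_eq)
  then show "kron_mat (1\<^sub>m m) (1\<^sub>m n) $$ (r, c) = 1\<^sub>m (m * n) $$ (r, c)"
    using rc div_mod_less[OF rc(1)] div_mod_less[OF rc(2)] by (auto simp: kron_mat_index)
qed simp_all

section \<open>The linear matrix inequality as a norm bound\<close>

text \<open>A kernel vector of \<open>F\<close> would be a nonzero zero of the quadratic form of \<open>transpose_mat F * F\<close>.\<close>
lemma pd_mat_factor_inverse:
  assumes F: "F \<in> carrier_mat k k" and pd: "pd_mat (transpose_mat F * F)"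
  obtains Fi where "Fi \<in> carrier_mat k k" "F * Fi = 1\<^sub>m k" "Fi * F = 1\<^sub>m k"
proof -
  have "det F \<noteq> 0"
  proof
    assume "det F = 0"
    then obtain v where v: "v \<in> carrier_vec k" "v \<noteq> 0\<^sub>v k" "F *\<^sub>v v = 0\<^sub>v k"
      using det_0_iff_vec_prod_zero[OF F] by auto
    then have "(transpose_mat F * F) *\<^sub>v v = transpose_mat F *\<^sub>v 0\<^sub>v k"
      using F by (simp add: assoc_mult_mat_vec[of _ k k _ k])
    also have "\<dots> = 0\<^sub>v k" using F by (intro eq_vecI) auto
    finally have "v \<bullet> ((transpose_mat F * F) *\<^sub>v v) = 0" using v by simp
    moreover have "0 < v \<bullet> ((transpose_mat F * F) *\<^sub>v v)"
      using pd v F unfolding pd_mat_def by auto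
    ultimately show False by simp
  qed
  then have "F \<in> Units (ring_mat TYPE(real) k ())" by (rule det_non_zero_imp_unit[OF F])
  then show thesis using that by (auto simp: Units_def ring_mat_simps)
qed

text \<open>Completing the square. Writing the upper right block as \<open>Q * M\<close>, with the same \<open>Q\<close> that factors
  the upper left block, keeps the inverse of that block out of the Schur complement
  $\tau I - M^{\top} M$.\<close>
lemma schur_quadratic_form:
  fixes Q M :: "real mat"
  assumes Q: "Q \<in> carrier_mat k k" and M: "M \<in> carrier_mat k c"
    and u: "u \<in> carrier_vec k" and v: "v \<in> carrier_vec c"
  shows "(u @\<^sub>v v) \<bullet> (four_block_mat (Q * transpose_mat Q) (Q * M)
      (transpose_mat (Q * M)) (\<tau> \<cdot>\<^sub>m 1\<^sub>m c) *\<^sub>v (u @\<^sub>v v)) =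
    (transpose_mat Q *\<^sub>v u + M *\<^sub>v v) \<bullet> (transpose_mat Q *\<^sub>v u + M *\<^sub>v v) -
    (M *\<^sub>v v) \<bullet> (M *\<^sub>v v) + \<tau> * (v \<bullet> v)"
proof -
  define x where "x = transpose_mat Q *\<^sub>v u"
  define y where "y = M *\<^sub>v v"
  have x: "x \<in> carrier_vec k" using Q u by (simp add: x_def)
  have y: "y \<in> carrier_vec k" using M v by (simp add: y_def)
  have Qt: "u \<bullet> (Q *\<^sub>v z) = x \<bullet> z" if z: "z \<in> carrier_vec k" for z
    using transpose_vec_mult_scalar[OF Q z u] by (simp add: x_def)
  have "transpose_mat (Q * M) *\<^sub>v u = transpose_mat M *\<^sub>v x"
    using Q M u unfolding x_def
    by (simp add: transpose_mult[OF Q M] assoc_mult_mat_vec[of _ c k _ k])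
  then have Mt: "v \<bullet> (transpose_mat (Q * M) *\<^sub>v u) = x \<bullet> y"
    using transpose_vec_mult_scalar[OF M v x] x y M v unfolding y_def
    by (metis comm_scalar_prod mult_mat_vec_carrier transpose_carrier_mat)
  have tau: "(\<tau> \<cdot>\<^sub>m 1\<^sub>m c) *\<^sub>v v = \<tau> \<cdot>\<^sub>v v"
    using v by (intro eq_vecI) auto
  have "four_block_mat (Q * transpose_mat Q) (Q * M)
      (transpose_mat (Q * M)) (\<tau> \<cdot>\<^sub>m 1\<^sub>m c) *\<^sub>v (u @\<^sub>v v) =
    (Q *\<^sub>v x + Q *\<^sub>v y) @\<^sub>v (transpose_mat (Q * M) *\<^sub>v u + \<tau> \<cdot>\<^sub>v v)"
    using four_block_mat_mult_vec[of "Q * transpose_mat Q" k k "Q * M" c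
        "transpose_mat (Q * M)" c "\<tau> \<cdot>\<^sub>m 1\<^sub>m c" u v] Q M u v
    by (simp add: x_def y_def tau assoc_mult_mat_vec[of _ k k _ k] assoc_mult_mat_vec[of _ k k _ c])
  moreover have carriers: "Q *\<^sub>v x \<in> carrier_vec k" "Q *\<^sub>v y \<in> carrier_vec k"
    "transpose_mat (Q * M) *\<^sub>v u \<in> carrier_vec c"
    using Q x y mult_mat_vec_carrier[OF _ u, of "transpose_mat (Q * M)" c] mult_carrier_mat[OF Q M]
    by auto
  ultimately have "(u @\<^sub>v v) \<bullet> (four_block_mat (Q * transpose_mat Q) (Q * M)
      (transpose_mat (Q * M)) (\<tau> \<cdot>\<^sub>m 1\<^sub>m c) *\<^sub>v (u @\<^sub>v v)) =
    x \<bullet> x + 2 * (x \<bullet> y) + \<tau> * (v \<bullet> v)"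
    using u v x y
    by (simp add: scalar_prod_append[of _ k _ c] scalar_prod_add_distrib[of _ k]
        scalar_prod_add_distrib[of _ c] Qt Mt)
  moreover have "(x + y) \<bullet> (x + y) = x \<bullet> x + 2 * (x \<bullet> y) + y \<bullet> y"
    using x y comm_scalar_prod[OF y x]
    by (simp add: scalar_prod_add_distrib[of _ k] add_scalar_prod_distrib[of _ k])
  ultimately show ?thesis by (simp add: x_def[symmetric] y_def[symmetric])
qed

lemma symmetric_schur_block:
  fixes Q M :: "real mat"
  assumes "Q \<in> carrier_mat k k" "M \<in> carrier_mat k c"
  shows "symmetric_mat (four_block_mat (Q * transpose_mat Q) (Q * M)
      (transpose_mat (Q * M)) (\<tau> \<cdot>\<^sub>m 1\<^sub>m c))"
  unfolding symmetric_mat_def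
  using assms
  by (subst transpose_four_block_mat[of _ k k _ c _ c])
    (auto simp: transpose_mult[of _ k k _ k] intro!: cong_four_block_mat eq_matI)

text \<open>In the completed square the vector \<open>u\<close> occurs only in a term that is nonnegative and, as \<open>Q\<close> is
  invertible, vanishes for a suitable \<open>u\<close>. Minimizing over \<open>u\<close> therefore leaves
  $\tau |v|^2 - |M v|^2$.\<close>
lemma psd_schur_block_iff:
  assumes Q: "Q \<in> carrier_mat k k" and Qi: "Qi \<in> carrier_mat k k" "Q * Qi = 1\<^sub>m k"
    and M: "M \<in> carrier_mat k c" and c: "0 < c"
  shows "psd_mat (four_block_mat (Q * transpose_mat Q) (Q * M)
      (transpose_mat (Q * M)) (\<tau> \<cdot>\<^sub>m 1\<^sub>m c)) \<longleftrightarrow> (spectral_norm M)\<^sup>2 \<le> \<tau>"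
    (is "psd_mat ?L \<longleftrightarrow> _")
proof -
  have dim: "dim_row ?L = k + c" using Q by simp
  have split: "\<exists>u v. w = u @\<^sub>v v \<and> u \<in> carrier_vec k \<and> v \<in> carrier_vec c"
    if "w \<in> carrier_vec (k + c)" for w :: "real vec"
    using that by (intro exI[of _ "vec_first w k"] exI[of _ "vec_last w c"]) simp
  have "psd_mat ?L \<longleftrightarrow> (\<forall>v\<in>carrier_vec c. (M *\<^sub>v v) \<bullet> (M *\<^sub>v v) \<le> \<tau> * (v \<bullet> v))"
  proof
    assume psd: "psd_mat ?L"
    show "\<forall>v\<in>carrier_vec c. (M *\<^sub>v v) \<bullet> (M *\<^sub>v v) \<le> \<tau> * (v \<bullet> v)"
    proof
      fix v :: "real vec" assume v: "v \<in> carrier_vec c"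
      \<comment> \<open>the choice that annihilates the square: the transpose of \<open>Q\<close> sends it to \<open>- (M *\<^sub>v v)\<close>\<close>
      define u where "u = transpose_mat Qi *\<^sub>v (- (M *\<^sub>v v))"
      have u: "u \<in> carrier_vec k" using Qi M v by (simp add: u_def)
      have "transpose_mat Q * transpose_mat Qi = 1\<^sub>m k"
      proof -
        have "Qi * Q = 1\<^sub>m k" using mat_mult_left_right_inverse[OF Q Qi] .
        then show ?thesis using transpose_mult[OF Qi(1) Q] by simp
      qed
      then have "transpose_mat Q *\<^sub>v u = - (M *\<^sub>v v)"
        using Q Qi M v unfolding u_def
        by (simp add: assoc_mult_mat_vec[of _ k k _ k, symmetric])
      then have "transpose_mat Q *\<^sub>v u + M *\<^sub>v v = 0\<^sub>v k"
        using M v by auto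
      then show "(M *\<^sub>v v) \<bullet> (M *\<^sub>v v) \<le> \<tau> * (v \<bullet> v)"
        using schur_quadratic_form[OF Q M u v, of \<tau>] psd u v
        unfolding psd_mat_def dim by force
    qed
  next
    assume bound: "\<forall>v\<in>carrier_vec c. (M *\<^sub>v v) \<bullet> (M *\<^sub>v v) \<le> \<tau> * (v \<bullet> v)"
    show "psd_mat ?L"
      unfolding psd_mat_def dim
    proof (intro conjI ballI symmetric_schur_block[OF Q M])
      fix w :: "real vec" assume "w \<in> carrier_vec (k + c)"
      then obtain u v where w: "w = u @\<^sub>v v" and uv: "u \<in> carrier_vec k" "v \<in> carrier_vec c"
        using split by blast
      show "0 \<le> w \<bullet> (?L *\<^sub>v w)"
        unfolding w schur_quadratic_form[OF Q M uv]
        using bound[rule_format, OF uv(2)]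
          scalar_prod_self_nonneg[of "transpose_mat Q *\<^sub>v u + M *\<^sub>v v"] by linarith
    qed
  qed
  also have "\<dots> \<longleftrightarrow> (spectral_norm M)\<^sup>2 \<le> \<tau>"
    using spectral_norm_power2_le_iff[of M \<tau>] M c by simp
  finally show ?thesis .
qed

text \<open>Strict feasibility: with \<open>\<tau>\<close> above the squared norm, \<open>v \<noteq> 0\<close> makes the Schur complement term
  positive, and if \<open>v = 0\<close>, the square itself is positive because \<open>Q\<close> is invertible.\<close>
lemma pd_schur_block:
  assumes Q: "Q \<in> carrier_mat k k" and Qi: "Qi \<in> carrier_mat k k" "Q * Qi = 1\<^sub>m k"
    and M: "M \<in> carrier_mat k c" and c: "0 < c" and strict: "(spectral_norm M)\<^sup>2 < \<tau>"
  shows "pd_mat (four_block_mat (Q * transpose_mat Q) (Q * M)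
      (transpose_mat (Q * M)) (\<tau> \<cdot>\<^sub>m 1\<^sub>m c))" (is "pd_mat ?L")
proof -
  have dim: "dim_row ?L = k + c" using Q by simp
  show ?thesis
    unfolding pd_mat_def dim
  proof (intro conjI ballI impI symmetric_schur_block[OF Q M])
    fix w :: "real vec" assume w: "w \<in> carrier_vec (k + c)" "w \<noteq> 0\<^sub>v (k + c)"
    define u where "u = vec_first w k"
    define v where "v = vec_last w c"
    have uv: "u \<in> carrier_vec k" "v \<in> carrier_vec c" and w_eq: "w = u @\<^sub>v v"
      using w(1) by (simp_all add: u_def v_def)
    define z where "z = transpose_mat Q *\<^sub>v u + M *\<^sub>v v"
    have form: "w \<bullet> (?L *\<^sub>v w) = z \<bullet> z - (M *\<^sub>v v) \<bullet> (M *\<^sub>v v) + \<tau> * (v \<bullet> v)"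
      unfolding w_eq z_def by (rule schur_quadratic_form[OF Q M uv])
    have bound: "(M *\<^sub>v v) \<bullet> (M *\<^sub>v v) \<le> (spectral_norm M)\<^sup>2 * (v \<bullet> v)"
      using spectral_norm_power2_le_iff[of M "(spectral_norm M)\<^sup>2"] M c uv by simp
    show "0 < w \<bullet> (?L *\<^sub>v w)"
    proof (cases "v = 0\<^sub>v c")
      case False
      then have "(spectral_norm M)\<^sup>2 * (v \<bullet> v) < \<tau> * (v \<bullet> v)"
        using strict scalar_prod_self_pos[OF uv(2)] by simp
      then show ?thesis
        unfolding form using bound scalar_prod_self_nonneg[of z] by linarith
    next
      case True
      have Mv: "M *\<^sub>v v = 0\<^sub>v k" using M True by (intro eq_vecI) auto
      have z: "z = transpose_mat Q *\<^sub>v u" using Q uv by (simp add: z_def Mv)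
      have "u \<noteq> 0\<^sub>v k"
        using w(2) True unfolding w_eq by (auto simp: append_vec_def)
      moreover have "u = transpose_mat Qi *\<^sub>v z"
      proof -
        have "transpose_mat Qi * transpose_mat Q = 1\<^sub>m k"
          using transpose_mult[OF Q Qi(1)] Qi(2) by simp
        then show ?thesis
          using Q Qi uv unfolding z by (simp add: assoc_mult_mat_vec[of _ k k _ k, symmetric])
      qed
      moreover have "transpose_mat Qi *\<^sub>v 0\<^sub>v k = 0\<^sub>v k"
        using Qi by (intro eq_vecI) auto
      ultimately have "z \<noteq> 0\<^sub>v k" by metis
      moreover have "z \<in> carrier_vec k" using Q uv by (simp add: z)
      ultimately show ?thesis
        unfolding form Mv using True scalar_prod_self_pos by simp
    qed
  qed
qed

section \<open>Gauge matrices and cyclic tuples\<close>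
lemma mult_kron_vec_index:
  assumes X: "X \<in> carrier_mat nr (N * N)" and w: "w \<in> carrier_vec N" and r: "r < nr"
  shows "(X *\<^sub>v kron_vec w w) $ r = (\<Sum>i<N. \<Sum>j<N. X $$ (r, i * N + j) * (w $ i * w $ j))"
proof -
  have "(X *\<^sub>v kron_vec w w) $ r = (\<Sum>k<N * N. X $$ (r, k) * kron_vec w w $ k)"
    using X w r by (intro mult_mat_vec_index_sum) (auto simp: kron_vec_def)
  also have "\<dots> = (\<Sum>k<N * N. X $$ (r, k div N * N + k mod N) * (w $ (k div N) * w $ (k mod N)))"
    using w by (intro sum.cong) (auto simp: kron_vec_def)
  also have "\<dots> = (\<Sum>i<N. \<Sum>j<N. X $$ (r, i * N + j) * (w $ i * w $ j))"
    by (rule sum_div_mod)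
  finally show ?thesis .
qed

text \<open>A quadratic form vanishes exactly if its matrix is skew; here this holds for each row \<open>r\<close> of \<open>X\<close>,
  read as a bilinear form in the two indices of the column.\<close>
lemma gauge_space_iff_skew:
  assumes X: "X \<in> carrier_mat N (N * N)"
  shows "X \<in> gauge_space N \<longleftrightarrow>
    (\<forall>r<N. \<forall>i<N. \<forall>j<N. X $$ (r, i * N + j) + X $$ (r, j * N + i) = 0)"
proof
  assume gauge: "X \<in> gauge_space N"
  have zero: "(\<Sum>i<N. \<Sum>j<N. X $$ (r, i * N + j) * (w $ i * w $ j)) = 0"
    if "w \<in> carrier_vec N" "r < N" for w r
    using gauge that mult_kron_vec_index[OF X that] by (auto simp: gauge_space_def)
  show "\<forall>r<N. \<forall>i<N. \<forall>j<N. X $$ (r, i * N + j) + X $$ (r, j * N + i) = 0"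
  proof (intro allI impI)
    fix r i j assume r: "r < N" and i: "i < N" and j: "j < N"
    have bil: "(\<Sum>i'<N. \<Sum>j'<N. X $$ (r, i' * N + j') *
        (unit_vec N a $ i' * unit_vec N b $ j')) = X $$ (r, a * N + b)"
      if "a < N" "b < N" for a b
    proof -
      have "(\<Sum>i'<N. \<Sum>j'<N. X $$ (r, i' * N + j') *
          (unit_vec N a $ i' * unit_vec N b $ j')) =
        (\<Sum>i'<N. \<Sum>j'<N. if i' = a then if j' = b then X $$ (r, i' * N + j') else 0 else 0)"
        using that by (intro sum.cong refl) auto
      also have "\<dots> =
        (\<Sum>i'<N. if i' = a then \<Sum>j'<N. if j' = b then X $$ (r, i' * N + j') else 0 else 0)"
        by (intro sum.cong refl) simp
      finally have "(\<Sum>i'<N. \<Sum>j'<N. X $$ (r, i' * N + j') *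
          (unit_vec N a $ i' * unit_vec N b $ j')) =
        (\<Sum>i'<N. if i' = a then \<Sum>j'<N. if j' = b then X $$ (r, i' * N + j') else 0 else 0)" .
      then show ?thesis using that by simp
    qed
    have diag: "X $$ (r, a * N + a) = 0" if "a < N" for a
      using bil[OF that that] zero[of "unit_vec N a" r] r by simp
    \<comment> \<open>polarization; the terms with a repeated index vanish by \<open>diag\<close>\<close>
    have "(\<Sum>i'<N. \<Sum>j'<N. X $$ (r, i' * N + j') * ((unit_vec N i + unit_vec N j) $ i' *
        (unit_vec N i + unit_vec N j) $ j')) =
      X $$ (r, i * N + i) + X $$ (r, i * N + j) + X $$ (r, j * N + i) + X $$ (r, j * N + j)"
      unfolding bil[OF i i, symmetric] bil[OF i j, symmetric] bil[OF j i, symmetric]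
        bil[OF j j, symmetric] sum.distrib[symmetric]
      by (intro sum.cong refl) (simp del: index_unit_vec(1) add: algebra_simps)
    then show "X $$ (r, i * N + j) + X $$ (r, j * N + i) = 0"
      using zero[of "unit_vec N i + unit_vec N j" r] r diag[OF i] diag[OF j] by simp
  qed
next
  assume skew: "\<forall>r<N. \<forall>i<N. \<forall>j<N. X $$ (r, i * N + j) + X $$ (r, j * N + i) = 0"
  have "X *\<^sub>v kron_vec w w = 0\<^sub>v N" if w: "w \<in> carrier_vec N" for w
  proof (rule eq_vecI)
    fix r assume "r < dim_vec (0\<^sub>v N :: real vec)"
    then have r: "r < N" by simp
    define S where "S = (\<Sum>i<N. \<Sum>j<N. X $$ (r, i * N + j) * (w $ i * w $ j))"
    have "S = (\<Sum>i<N. \<Sum>j<N. X $$ (r, j * N + i) * (w $ j * w $ i))"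
      unfolding S_def by (rule sum.swap)
    then have "S + S = (\<Sum>i<N. \<Sum>j<N.
        (X $$ (r, i * N + j) + X $$ (r, j * N + i)) * (w $ i * w $ j))"
      unfolding S_def by (simp add: sum.distrib algebra_simps)
    also have "\<dots> = 0" using skew r by (intro sum.neutral ballI) simp
    finally show "(X *\<^sub>v kron_vec w w) $ r = 0\<^sub>v N $ r"
      unfolding mult_kron_vec_index[OF X w r] S_def[symmetric] using r by simp
  qed (use X in auto)
  then show "X \<in> gauge_space N" using X by (simp add: gauge_space_def)
qed

lemma lin_comb_gauge_space:
  assumes M: "\<And>k. k < dim_vec c \<Longrightarrow> M k \<in> gauge_space N"
  shows "lin_comb N (N * N) c M \<in> gauge_space N"
  unfolding gauge_space_iff_skew[OF lin_comb_carrier]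
proof (intro allI impI)
  fix r i j assume r: "r < N" and ij: "i < N" "j < N"
  have "M k $$ (r, i * N + j) + M k $$ (r, j * N + i) = 0" if "k < dim_vec c" for k
    using M[OF that] gauge_space_iff_skew[of "M k" N] r ij by (auto simp: gauge_space_def)
  then have "(\<Sum>k<dim_vec c. c $ k * (M k $$ (r, i * N + j) + M k $$ (r, j * N + i))) = 0"
    by (intro sum.neutral ballI) simp
  then show "lin_comb N (N * N) c M $$ (r, i * N + j) +
      lin_comb N (N * N) c M $$ (r, j * N + i) = 0"
    unfolding lin_comb_index[OF r mult_add_less[OF ij]]
      lin_comb_index[OF r mult_add_less[OF ij(2,1)]] sum.distrib[symmetric]
      distrib_left[symmetric] .
qed

lemma lyap_stack_dim [simp]:
  "dim_row (lyap_stack N P X) = N * N" "dim_col (lyap_stack N P X) = N"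
  by (simp_all add: lyap_stack_def col_stack_def)

lemma lyap_stack_carrier [simp]: "lyap_stack N P X \<in> carrier_mat (N * N) N"
  by (simp add: lyap_stack_def col_stack_def)

lemma slice_carrier [simp]: "slice N X i \<in> carrier_mat N N"
  by (simp add: slice_def)

lemma dim_slice [simp]: "dim_row (slice N X i) = N" "dim_col (slice N X i) = N"
  by (simp_all add: slice_def)

text \<open>The two products are merged into one sum because linearity, symmetry and the cyclic identity
  below all hold for each \<open>l\<close> separately.\<close>
lemma lyap_slice_index:
  assumes P: "P \<in> carrier_mat N N" and jc: "j < N" "c < N"
  shows "(transpose_mat (slice N X i) * P + P * slice N X i) $$ (j, c) =
    (\<Sum>l<N. X $$ (l, i * N + j) * P $$ (l, c) + P $$ (j, l) * X $$ (l, i * N + c))"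
proof -
  have "(transpose_mat (slice N X i) * P) $$ (j, c) = (\<Sum>l<N. X $$ (l, i * N + j) * P $$ (l, c))"
    using assms by (subst mult_mat_index_sum[of _ N N _ N]) (auto simp: slice_def)
  moreover have "(P * slice N X i) $$ (j, c) = (\<Sum>l<N. P $$ (j, l) * X $$ (l, i * N + c))"
    using assms by (subst mult_mat_index_sum[of _ N N _ N]) (auto simp: slice_def)
  moreover have "transpose_mat (slice N X i) * P \<in> carrier_mat N N"
    "P * slice N X i \<in> carrier_mat N N"
    using P by (auto simp: slice_def)
  ultimately show ?thesis
    using jc carrier_matD[OF P] by (simp add: sum.distrib del: index_mult_mat(1))
qed

lemma lyap_stack_index:
  assumes P: "P \<in> carrier_mat N N" and rc: "r < N * N" "c < N"
  shows "lyap_stack N P X $$ (r, c) = (\<Sum>l<N. X $$ (l, r div N * N + r mod N) * P $$ (l, c) +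
    P $$ (r mod N, l) * X $$ (l, r div N * N + c))"
proof -
  have "lyap_stack N P X $$ (r, c) = (transpose_mat (slice N X (r div N)) * P +
      P * slice N X (r div N)) $$ (r mod N, c)"
    using rc by (simp add: lyap_stack_def col_stack_def)
  then show ?thesis using lyap_slice_index[OF P div_mod_less(2)[OF rc(1)] rc(2)] by simp
qed

lemma lyap_stack_add:
  assumes P: "P \<in> carrier_mat N N" and Y: "Y \<in> carrier_mat N (N * N)"
  shows "lyap_stack N P (X + Y) = lyap_stack N P X + lyap_stack N P Y"
proof (rule eq_matI)
  fix r c assume "r < dim_row (lyap_stack N P X + lyap_stack N P Y)"
    "c < dim_col (lyap_stack N P X + lyap_stack N P Y)"
  then have rc: "r < N * N" "c < N" by simp_all
  have ix: "r div N * N + r mod N < N * N" "r div N * N + c < N * N"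
    using rc div_mod_less[OF rc(1)] by (simp_all add: mult_add_less)
  show "lyap_stack N P (X + Y) $$ (r, c) = (lyap_stack N P X + lyap_stack N P Y) $$ (r, c)"
    using rc ix Y by (simp add: lyap_stack_index[OF P rc] sum.distrib[symmetric]
        algebra_simps del: div_mult_mod_eq mod_div_mult_eq mult_div_mod_eq mod_mult_div_eq)
qed simp_all

lemma lyap_stack_lin_comb:
  assumes P: "P \<in> carrier_mat N N"
  shows "lyap_stack N P (lin_comb N (N * N) c M) =
    lin_comb (N * N) N c (\<lambda>k. lyap_stack N P (M k))"
proof (rule eq_matI)
  fix r s assume "r < dim_row (lin_comb (N * N) N c (\<lambda>k. lyap_stack N P (M k)))"
    "s < dim_col (lin_comb (N * N) N c (\<lambda>k. lyap_stack N P (M k)))"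
  then have rs: "r < N * N" "s < N" by simp_all
  have ix: "r div N * N + r mod N < N * N" "r div N * N + s < N * N"
    using rs div_mod_less[OF rs(1)] by (simp_all add: mult_add_less)
  have "lyap_stack N P (lin_comb N (N * N) c M) $$ (r, s) =
    (\<Sum>l<N. \<Sum>k<dim_vec c. c $ k * (M k $$ (l, r div N * N + r mod N) * P $$ (l, s) +
      P $$ (r mod N, l) * M k $$ (l, r div N * N + s)))"
    unfolding lyap_stack_index[OF P rs]
  proof (intro sum.cong refl)
    fix l assume "l \<in> {..<N}"
    then have l: "l < N" by simp
    have "(\<Sum>k<dim_vec c. c $ k * f k) * x + y * (\<Sum>k<dim_vec c. c $ k * g k) =
        (\<Sum>k<dim_vec c. c $ k * (f k * x + y * g k))" for f g x y
      by (simp add: sum_distrib_left sum_distrib_right sum.distrib algebra_simps)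
    then show "lin_comb N (N * N) c M $$ (l, r div N * N + r mod N) * P $$ (l, s) +
        P $$ (r mod N, l) * lin_comb N (N * N) c M $$ (l, r div N * N + s) =
      (\<Sum>k<dim_vec c. c $ k * (M k $$ (l, r div N * N + r mod N) * P $$ (l, s) +
        P $$ (r mod N, l) * M k $$ (l, r div N * N + s)))"
      unfolding lin_comb_index[OF l ix(1)] lin_comb_index[OF l ix(2)] .
  qed
  also have "\<dots> = (\<Sum>k<dim_vec c. c $ k * lyap_stack N P (M k) $$ (r, s))"
    unfolding lyap_stack_index[OF P rs] sum_distrib_left by (rule sum.swap)
  finally show "lyap_stack N P (lin_comb N (N * N) c M) $$ (r, s) =
      lin_comb (N * N) N c (\<lambda>k. lyap_stack N P (M k)) $$ (r, s)"
    by (simp add: lin_comb_index[OF rs])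
qed simp_all

text \<open>In the cyclic sum every summand $X_{l,(i,j)} P_{l k}$ meets $P_{k l} X_{l,(j,i)}$, and the two
  cancel by skewness of \<open>X\<close> and symmetry of \<open>P\<close>.\<close>
lemma lyap_gauge_cyclic:
  assumes P: "P \<in> carrier_mat N N" "symmetric_mat P" and X: "X \<in> gauge_space N"
  shows "(\<lambda>i. transpose_mat (slice N X i) * P + P * slice N X i) \<in> cyclic_space N"
proof -
  let ?B = "\<lambda>i. transpose_mat (slice N X i) * P + P * slice N X i"
  have PT: "P $$ (j, l) = P $$ (l, j)" if "j < N" "l < N" for j l
    using P that unfolding symmetric_mat_def by (metis carrier_matD index_transpose_mat(1))
  have Xc: "X \<in> carrier_mat N (N * N)" using X by (simp add: gauge_space_def)
  have skew: "X $$ (r, i * N + j) = - X $$ (r, j * N + i)" if "r < N" "i < N" "j < N" for r i j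
    using X that unfolding gauge_space_iff_skew[OF Xc] by (simp add: eq_neg_iff_add_eq_0)
  have B: "?B i \<in> carrier_mat N N" for i
    using P by (intro add_carrier_mat mult_carrier_mat[of _ N N]) auto
  have "symmetric_mat (?B i)" for i
    unfolding symmetric_mat_def
  proof (rule eq_matI)
    fix j k assume "j < dim_row (?B i)" "k < dim_col (?B i)"
    then have jk: "j < N" "k < N" using B[of i] by auto
    have "transpose_mat (?B i) $$ (j, k) = ?B i $$ (k, j)"
      using jk B[of i] by (simp del: index_add_mat index_mult_mat)
    also have "\<dots> = ?B i $$ (j, k)"
      unfolding lyap_slice_index[OF P(1) jk] lyap_slice_index[OF P(1) jk(2,1)]
      by (intro sum.cong refl) (use jk PT in \<open>simp add: algebra_simps\<close>)
    finally show "transpose_mat (?B i) $$ (j, k) = ?B i $$ (j, k)" .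
  qed (use carrier_matD[OF P(1)] in auto)
  moreover have "?B i $$ (j, k) + ?B j $$ (k, i) + ?B k $$ (i, j) = 0"
    if ijk: "i < N" "j < N" "k < N" for i j k
  proof -
    have "(X $$ (l, i * N + j) * P $$ (l, k) + P $$ (j, l) * X $$ (l, i * N + k)) +
        (X $$ (l, j * N + k) * P $$ (l, i) + P $$ (k, l) * X $$ (l, j * N + i)) +
        (X $$ (l, k * N + i) * P $$ (l, j) + P $$ (i, l) * X $$ (l, k * N + j)) = 0"
      if l: "l < N" for l
      using skew[OF l ijk(1,2)] skew[OF l ijk(2,3)] skew[OF l ijk(3,1)]
        PT[OF ijk(1) l] PT[OF ijk(2) l] PT[OF ijk(3) l] by simp
    then show ?thesis
      unfolding lyap_slice_index[OF P(1) ijk(2,3)] lyap_slice_index[OF P(1) ijk(3,1)]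
        lyap_slice_index[OF P(1) ijk(1,2)] sum.distrib[symmetric]
      by (intro sum.neutral ballI) simp
  qed
  ultimately show ?thesis using B unfolding cyclic_space_def by blast
qed

lemma cyclic_space_swap:
  assumes "B \<in> cyclic_space N" "i < N" "j < N" "k < N"
  shows "B i $$ (j, k) = B i $$ (k, j)"
proof -
  have "B i \<in> carrier_mat N N" "transpose_mat (B i) = B i"
    using assms by (auto simp: cyclic_space_def symmetric_mat_def)
  then show ?thesis using assms(3,4) by (metis carrier_matD index_transpose_mat(1))
qed

text \<open>The inverse construction. With $T_i = P S_i$ for the slices $S_i$ of \<open>X\<close>, the task is to find $T$
  with $T_i + T_i^{\top} = B_i$ and $(T_i)_{jk} = -(T_k)_{ji}$. The skew part of $B$ in the indices
  $i$ and $k$ has the second property for any scaling, and its symmetrization is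
  $2 (B_i)_{jk} - (B_k)_{ij} - (B_j)_{ki}$, which the cyclic identity turns into $3 (B_i)_{jk}$.
  This explains the factor $1/3$.\<close>
lemma cyclic_lyap_gauge:
  assumes P: "P \<in> carrier_mat N N" "symmetric_mat P"
    and R: "R \<in> carrier_mat N N" "P * R = 1\<^sub>m N"
    and B: "B \<in> cyclic_space N"
  shows "\<exists>X\<in>gauge_space N. \<forall>i<N. transpose_mat (slice N X i) * P + P * slice N X i = B i"
proof -
  define T where "T i = mat N N (\<lambda>(j, k). (B i $$ (j, k) - B k $$ (j, i)) / 3)" for i
  define X where "X = mat N (N * N) (\<lambda>(r, c). (R * T (c div N)) $$ (r, c mod N))"
  have T: "T i \<in> carrier_mat N N" for i by (simp add: T_def)
  have Bc: "B i \<in> carrier_mat N N" "symmetric_mat (B i)" if "i < N" for i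
    using B that by (auto simp: cyclic_space_def)
  note BT = cyclic_space_swap[OF B]
  have cyc: "B i $$ (j, k) + B j $$ (k, i) + B k $$ (i, j) = 0"
    if "i < N" "j < N" "k < N" for i j k
    using B that by (auto simp: cyclic_space_def)
  have X: "X \<in> carrier_mat N (N * N)" by (simp add: X_def)
  have X_index: "X $$ (r, i * N + j) = (R * T i) $$ (r, j)" if "r < N" "i < N" "j < N" for r i j
    using that by (simp add: X_def mult_add_less)
  have slice: "slice N X i = R * T i" if "i < N" for i
    using R T[of i] that by (intro eq_matI) (auto simp del: index_mult_mat(1) simp: slice_def X_index)
  have "X \<in> gauge_space N"
    unfolding gauge_space_iff_skew[OF X]
  proof (intro allI impI)
    fix r i j assume rij: "r < N" "i < N" "j < N"
    show "X $$ (r, i * N + j) + X $$ (r, j * N + i) = 0"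
      unfolding X_index[OF rij] X_index[OF rij(1,3,2)]
        mult_mat_index_sum[OF R(1) T rij(1,3)] mult_mat_index_sum[OF R(1) T rij(1,2)]
        sum.distrib[symmetric]
      using rij by (intro sum.neutral ballI) (simp add: T_def field_simps)
  qed
  moreover have "transpose_mat (slice N X i) * P + P * slice N X i = B i" if i: "i < N" for i
  proof -
    have PS: "P * slice N X i = T i"
      using assoc_mult_mat[OF P(1) R(1) T[of i]] T[of i] by (simp add: slice[OF i] R(2))
    have "transpose_mat (slice N X i) * P = transpose_mat (P * slice N X i)"
      using transpose_mult[OF P(1) slice_carrier, of X i] P(2) by (simp add: symmetric_mat_def)
    then have "transpose_mat (slice N X i) * P + P * slice N X i = transpose_mat (T i) + T i"
      by (simp add: PS)
    also have "\<dots> = B i"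
    proof (rule eq_matI)
      fix j k assume "j < dim_row (B i)" "k < dim_col (B i)"
      then have jk: "j < N" "k < N" using Bc[OF i] by auto
      show "(transpose_mat (T i) + T i) $$ (j, k) = B i $$ (j, k)"
        using cyc[OF i jk] BT[OF i jk] BT[OF jk(1) i jk(2)] BT[OF jk(2) i jk(1)] jk i
        by (simp add: T_def field_simps)
    qed (use Bc[OF i] in \<open>auto simp: T_def\<close>)
    finally show ?thesis .
  qed
  ultimately show ?thesis by blast
qed

lemma col_stack_cong: "(\<And>i. i < N \<Longrightarrow> B i = B' i) \<Longrightarrow> col_stack N B = col_stack N B'"
  unfolding col_stack_def by (intro cong_mat refl) (auto simp: div_mod_less)

text \<open>The reduction of the gauge: a certificate sees the gauge parameter \<open>\<mu>\<close> only through a cyclic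
  tuple, and every cyclic tuple occurs.\<close>
lemma lyap_stack_gauge_image:
  assumes P: "P \<in> carrier_mat N N" "symmetric_mat P"
    and R: "R \<in> carrier_mat N N" "P * R = 1\<^sub>m N"
    and K: "gauge_basis N d K"
  shows "(\<lambda>\<mu>. lyap_stack N P (gauge_mat N K \<mu>)) ` carrier_vec d = col_stack N ` cyclic_space N"
proof (intro equalityI subsetI)
  fix Y assume "Y \<in> (\<lambda>\<mu>. lyap_stack N P (gauge_mat N K \<mu>)) ` carrier_vec d"
  then obtain \<mu> where \<mu>: "\<mu> \<in> carrier_vec d" "Y = lyap_stack N P (gauge_mat N K \<mu>)" by blast
  have "gauge_mat N K \<mu> \<in> gauge_space N"
    unfolding gauge_mat_def using K \<mu>(1) by (intro lin_comb_gauge_space) (auto simp: gauge_basis_def)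
  then show "Y \<in> col_stack N ` cyclic_space N"
    unfolding \<mu>(2) lyap_stack_def by (intro imageI lyap_gauge_cyclic[OF P])
next
  fix Y assume "Y \<in> col_stack N ` cyclic_space N"
  then obtain B where B: "B \<in> cyclic_space N" "Y = col_stack N B" by blast
  obtain X where X: "X \<in> gauge_space N"
    "\<forall>i<N. transpose_mat (slice N X i) * P + P * slice N X i = B i"
    using cyclic_lyap_gauge[OF P R B(1)] by blast
  obtain \<mu> where \<mu>: "\<mu> \<in> carrier_vec d" "X = gauge_mat N K \<mu>"
    using K X(1) unfolding gauge_basis_def gauge_mat_def by blast
  have "lyap_stack N P X = Y"
    unfolding lyap_stack_def B(2) by (rule col_stack_cong) (use X(2) in blast)
  then show "Y \<in> (\<lambda>\<mu>. lyap_stack N P (gauge_mat N K \<mu>)) ` carrier_vec d"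
    using \<mu> by blast
qed

lemma reduced_stack_eq_col_stack:
  "reduced_stack N B \<nu> = col_stack N (\<lambda>i. lin_comb N N \<nu> (\<lambda>l. B l i))"
  unfolding reduced_stack_def
proof (rule eq_matI)
  fix r c assume "r < dim_row (col_stack N (\<lambda>i. lin_comb N N \<nu> (\<lambda>l. B l i)))"
    "c < dim_col (col_stack N (\<lambda>i. lin_comb N N \<nu> (\<lambda>l. B l i)))"
  then have rc: "r < N * N" "c < N" by (simp_all add: col_stack_def)
  then show "lin_comb (N * N) N \<nu> (\<lambda>l. col_stack N (B l)) $$ (r, c) =
      col_stack N (\<lambda>i. lin_comb N N \<nu> (\<lambda>l. B l i)) $$ (r, c)"
    using div_mod_less[OF rc(1)] by (simp add: lin_comb_index col_stack_def)
qed (simp_all add: col_stack_def)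

lemma lin_comb_cyclic_space:
  assumes B: "\<And>l. l < dim_vec \<nu> \<Longrightarrow> B l \<in> cyclic_space N"
  shows "(\<lambda>i. lin_comb N N \<nu> (\<lambda>l. B l i)) \<in> cyclic_space N"
proof -
  note BT = cyclic_space_swap[OF B]
  have "symmetric_mat (lin_comb N N \<nu> (\<lambda>l. B l i))" if "i < N" for i
    unfolding symmetric_mat_def
    using BT that by (intro eq_matI) (auto simp: lin_comb_index intro!: sum.cong)
  moreover have "lin_comb N N \<nu> (\<lambda>l. B l i) $$ (j, k) + lin_comb N N \<nu> (\<lambda>l. B l j) $$ (k, i) +
      lin_comb N N \<nu> (\<lambda>l. B l k) $$ (i, j) = 0" if ijk: "i < N" "j < N" "k < N" for i j k
  proof -
    have "\<nu> $ l * B l i $$ (j, k) + \<nu> $ l * B l j $$ (k, i) + \<nu> $ l * B l k $$ (i, j) = 0"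
      if "l < dim_vec \<nu>" for l
      using B[OF that] ijk unfolding cyclic_space_def by (simp add: distrib_left[symmetric])
    then show ?thesis
      using ijk by (simp add: lin_comb_index sum.distrib[symmetric])
  qed
  ultimately show ?thesis by (simp add: cyclic_space_def)
qed

lemma reduced_stack_image:
  assumes B: "cyclic_basis N q B"
  shows "reduced_stack N B ` carrier_vec q = col_stack N ` cyclic_space N"
proof (intro equalityI subsetI)
  fix Y assume "Y \<in> reduced_stack N B ` carrier_vec q"
  then obtain \<nu> where \<nu>: "\<nu> \<in> carrier_vec q" "Y = reduced_stack N B \<nu>" by blast
  show "Y \<in> col_stack N ` cyclic_space N"
    unfolding \<nu>(2) reduced_stack_eq_col_stack
    using B \<nu>(1) by (intro imageI lin_comb_cyclic_space) (auto simp: cyclic_basis_def)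
next
  fix Y assume "Y \<in> col_stack N ` cyclic_space N"
  then obtain X where X: "X \<in> cyclic_space N" "Y = col_stack N X" by blast
  then obtain \<nu> where \<nu>: "\<nu> \<in> carrier_vec q" "\<forall>i<N. X i = lin_comb N N \<nu> (\<lambda>l. B l i)"
    using B unfolding cyclic_basis_def by blast
  have "Y = reduced_stack N B \<nu>"
    unfolding X(2) reduced_stack_eq_col_stack by (rule col_stack_cong) (use \<nu>(2) in blast)
  then show "Y \<in> reduced_stack N B ` carrier_vec q" using \<nu>(1) by blast
qed

text \<open>Membership as a list of linear equations between entries, from which closedness under entrywise
  limits can be read off.\<close>
lemma col_stack_cyclic_iff:
  assumes M: "M \<in> carrier_mat (N * N) N"
  shows "M \<in> col_stack N ` cyclic_space N \<longleftrightarrow>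
    (\<forall>i<N. \<forall>j<N. \<forall>k<N. M $$ (i * N + j, k) = M $$ (i * N + k, j)) \<and>
    (\<forall>i<N. \<forall>j<N. \<forall>k<N. M $$ (i * N + j, k) + M $$ (j * N + k, i) + M $$ (k * N + i, j) = 0)"
    (is "_ \<longleftrightarrow> ?sym \<and> ?cyc")
proof
  assume "M \<in> col_stack N ` cyclic_space N"
  then obtain B where B: "B \<in> cyclic_space N" "M = col_stack N B" by blast
  have idx: "M $$ (i * N + j, k) = B i $$ (j, k)" if "i < N" "j < N" "k < N" for i j k
    using that by (simp add: B(2) col_stack_def mult_add_less)
  show "?sym \<and> ?cyc"
  proof (intro conjI allI impI)
    fix i j k assume ijk: "i < N" "j < N" "k < N"
    show "M $$ (i * N + j, k) = M $$ (i * N + k, j)"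
      unfolding idx[OF ijk] idx[OF ijk(1,3,2)] by (rule cyclic_space_swap[OF B(1) ijk])
    show "M $$ (i * N + j, k) + M $$ (j * N + k, i) + M $$ (k * N + i, j) = 0"
      unfolding idx[OF ijk] idx[OF ijk(2,3,1)] idx[OF ijk(3,1,2)]
      using B(1) ijk by (simp add: cyclic_space_def)
  qed
next
  assume M': "?sym \<and> ?cyc"
  define B where "B i = mat N N (\<lambda>(j, k). M $$ (i * N + j, k))" for i
  have "symmetric_mat (B i)" if i: "i < N" for i
    unfolding symmetric_mat_def
  proof (rule eq_matI)
    fix j k assume "j < dim_row (B i)" "k < dim_col (B i)"
    then have jk: "j < N" "k < N" by (simp_all add: B_def)
    then show "transpose_mat (B i) $$ (j, k) = B i $$ (j, k)"
      using M'[THEN conjunct1, rule_format, OF i jk(2,1)] by (simp add: B_def)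
  qed (simp_all add: B_def)
  moreover have "B i $$ (j, k) + B j $$ (k, i) + B k $$ (i, j) = 0"
    if ijk: "i < N" "j < N" "k < N" for i j k
    using M'[THEN conjunct2, rule_format, OF ijk] ijk by (simp add: B_def)
  ultimately have "B \<in> cyclic_space N"
    by (simp add: cyclic_space_def B_def)
  moreover have "M = col_stack N B"
  proof (rule eq_matI)
    fix r c assume "r < dim_row (col_stack N B)" "c < dim_col (col_stack N B)"
    then have rc: "r < N * N" "c < N" by (simp_all add: col_stack_def)
    then show "M $$ (r, c) = col_stack N B $$ (r, c)"
      using div_mod_less[OF rc(1)] by (simp add: col_stack_def B_def)
  qed (use M in \<open>auto simp: col_stack_def\<close>)
  ultimately show "M \<in> col_stack N ` cyclic_space N" by blast
qed

lemma col_stack_cyclic_closed: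
  assumes Y: "\<And>k. Y k \<in> col_stack N ` cyclic_space N" and M: "M \<in> carrier_mat (N * N) N"
    and lim: "\<And>r c. r < N * N \<Longrightarrow> c < N \<Longrightarrow> (\<lambda>k. Y k $$ (r, c)) \<longlonglongrightarrow> M $$ (r, c)"
  shows "M \<in> col_stack N ` cyclic_space N"
proof -
  have Yc: "Y k \<in> carrier_mat (N * N) N" for k
    using Y[of k] by (auto simp: col_stack_def)
  note Y_iff = Y[unfolded col_stack_cyclic_iff[OF Yc]]
  show ?thesis
    unfolding col_stack_cyclic_iff[OF M]
  proof (intro conjI allI impI)
    fix i j k assume ijk: "i < N" "j < N" "k < N"
    show "M $$ (i * N + j, k) = M $$ (i * N + k, j)"
    proof (rule LIMSEQ_unique)
      show "(\<lambda>l. Y l $$ (i * N + j, k)) \<longlonglongrightarrow> M $$ (i * N + j, k)"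
        using ijk by (intro lim mult_add_less)
      have "Y l $$ (i * N + j, k) = Y l $$ (i * N + k, j)" for l
        using Y_iff[THEN conjunct1, rule_format, OF ijk] .
      then show "(\<lambda>l. Y l $$ (i * N + j, k)) \<longlonglongrightarrow> M $$ (i * N + k, j)"
        using lim[OF mult_add_less[OF ijk(1,3)] ijk(2)] by presburger
    qed
    have "(\<lambda>l. Y l $$ (i * N + j, k) + Y l $$ (j * N + k, i) + Y l $$ (k * N + i, j)) \<longlonglongrightarrow>
        M $$ (i * N + j, k) + M $$ (j * N + k, i) + M $$ (k * N + i, j)"
      using ijk by (intro tendsto_add lim mult_add_less)
    moreover have "Y l $$ (i * N + j, k) + Y l $$ (j * N + k, i) + Y l $$ (k * N + i, j) = 0" for l
      using Y_iff[THEN conjunct2, rule_format, OF ijk] .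
    ultimately show "M $$ (i * N + j, k) + M $$ (j * N + k, i) + M $$ (k * N + i, j) = 0"
      by (simp add: LIMSEQ_const_iff)
  qed
qed

section \<open>The optimal certificate\<close>

text \<open>The minimization runs over the whitened matrices \<open>Qi * (G + Y)\<close> and not over parameters of \<open>Y\<close>,
  because the spectral norm is coercive in their entries; multiplication by \<open>Q\<close> carries limits back to \<open>V\<close>.\<close>
lemma whitened_norm_attains_minimum:
  assumes Q: "Q \<in> carrier_mat k k" and Qi: "Qi \<in> carrier_mat k k" "Q * Qi = 1\<^sub>m k" "Qi * Q = 1\<^sub>m k"
    and G: "G \<in> carrier_mat k c" and V: "V \<subseteq> carrier_mat k c" "V \<noteq> {}"
    and closed: "\<And>Y M. (\<And>i. Y i \<in> V) \<Longrightarrow> M \<in> carrier_mat k c \<Longrightarrow>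
       (\<And>r s. r < k \<Longrightarrow> s < c \<Longrightarrow> (\<lambda>i. Y i $$ (r, s)) \<longlonglongrightarrow> M $$ (r, s)) \<Longrightarrow> M \<in> V"
  shows "\<exists>Y\<in>V. \<forall>Y'\<in>V. spectral_norm (Qi * (G + Y)) \<le> spectral_norm (Qi * (G + Y'))"
proof -
  have QQi: "Q * (Qi * X) = X" and QiQ: "Qi * (Q * X) = X" if "X \<in> carrier_mat k c" for X
    using that assoc_mult_mat[OF Q Qi(1) that] assoc_mult_mat[OF Qi(1) Q that] Qi by simp_all
  have "\<exists>M\<in>(\<lambda>Y. Qi * (G + Y)) ` V. \<forall>M'\<in>(\<lambda>Y. Qi * (G + Y)) ` V.
      spectral_norm M \<le> spectral_norm M'"
  proof (rule spectral_norm_attains_minimum[of _ k c])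
    show "(\<lambda>Y. Qi * (G + Y)) ` V \<subseteq> carrier_mat k c" using V Qi by auto
    show "(\<lambda>Y. Qi * (G + Y)) ` V \<noteq> {}" using V by simp
    fix X M
    assume X: "\<And>i. X i \<in> (\<lambda>Y. Qi * (G + Y)) ` V" and M: "M \<in> carrier_mat k c"
      and lim: "\<And>r s. r < k \<Longrightarrow> s < c \<Longrightarrow> (\<lambda>i. X i $$ (r, s)) \<longlonglongrightarrow> M $$ (r, s)"
    have "\<forall>i. \<exists>Y\<in>V. X i = Qi * (G + Y)" using X by blast
    then obtain Y where Y: "\<And>i. Y i \<in> V" "\<And>i. X i = Qi * (G + Y i)" by metis
    have Yc: "Y i \<in> carrier_mat k c" for i using Y(1) V by blast
    have Xc: "X i \<in> carrier_mat k c" for i using Y(2)[of i] Qi Yc[of i] by auto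
    have "Q * M - G \<in> V"
    proof (rule closed[OF Y(1)])
      show "Q * M - G \<in> carrier_mat k c" using G by auto
      fix r s assume rs: "r < k" "s < c"
      have "Q * X i = G + Y i" for i using QQi[of "G + Y i"] Yc[of i] Y(2) G by simp
      then have "Y i $$ (r, s) = (\<Sum>l<k. Q $$ (r, l) * X i $$ (l, s)) - G $$ (r, s)" for i
        using mult_mat_index_sum[OF Q Xc rs, of i] rs Yc[of i] G by simp
      moreover have "(\<lambda>i. (\<Sum>l<k. Q $$ (r, l) * X i $$ (l, s)) - G $$ (r, s)) \<longlonglongrightarrow>
          (\<Sum>l<k. Q $$ (r, l) * M $$ (l, s)) - G $$ (r, s)"
        using rs by (intro tendsto_intros lim) auto
      moreover have "(Q * M - G) $$ (r, s) = (\<Sum>l<k. Q $$ (r, l) * M $$ (l, s)) - G $$ (r, s)"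
        using rs G mult_mat_index_sum[OF Q M rs] by simp
      ultimately show "(\<lambda>i. Y i $$ (r, s)) \<longlonglongrightarrow> (Q * M - G) $$ (r, s)" by presburger
    qed
    moreover have "G + (Q * M - G) = Q * M"
      using G Q M by (intro eq_matI) (auto simp del: index_mult_mat(1))
    then have "M = Qi * (G + (Q * M - G))" using QiQ[OF M] by simp
    ultimately show "M \<in> (\<lambda>Y. Qi * (G + Y)) ` V" by blast
  qed
  then show ?thesis by blast
qed

text \<open>In the notation of the certificate, \<open>F\<close> is the factor $P_f$ of $P$, so that \<open>Q\<close> is the matrix
  whose inverse whitens $G$ and $Q Q^{\top} = P \otimes I_N$ is the upper left block of the matrix
  inequality. Invertibility of \<open>Q\<close> also ensures that \<open>mat_inverse\<close> returns a value.\<close>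
lemma kron_factor_inverse:
  assumes F: "F \<in> carrier_mat N N" and pd: "pd_mat (transpose_mat F * F)"
    and Q_def: "Q = kron_mat (transpose_mat F) (1\<^sub>m N)" and Qi_def: "Qi = the (mat_inverse Q)"
  shows "Q \<in> carrier_mat (N * N) (N * N)" "Qi \<in> carrier_mat (N * N) (N * N)"
    "Q * Qi = 1\<^sub>m (N * N)" "Qi * Q = 1\<^sub>m (N * N)"
    "Q * transpose_mat Q = kron_mat (transpose_mat F * F) (1\<^sub>m N)"
    "\<exists>R\<in>carrier_mat N N. (transpose_mat F * F) * R = 1\<^sub>m N"
proof -
  obtain Fi where Fi: "Fi \<in> carrier_mat N N" "F * Fi = 1\<^sub>m N" "Fi * F = 1\<^sub>m N"
    using pd_mat_factor_inverse[OF F pd] .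
  have FT: "transpose_mat F * transpose_mat Fi = 1\<^sub>m N" "transpose_mat Fi * transpose_mat F = 1\<^sub>m N"
    by (simp_all add: transpose_mult[OF Fi(1) F, symmetric] transpose_mult[OF F Fi(1), symmetric] Fi)
  show Q: "Q \<in> carrier_mat (N * N) (N * N)" using F by (auto simp: Q_def)
  let ?W = "kron_mat (transpose_mat Fi) (1\<^sub>m N)"
  have "Q * ?W = 1\<^sub>m (N * N)" "?W * Q = 1\<^sub>m (N * N)"
    using F Fi FT by (simp_all add: Q_def kron_mat_mult kron_mat_one)
  moreover have "?W \<in> carrier_mat (N * N) (N * N)" using Fi(1) by auto
  ultimately have "Q \<in> Units (ring_mat TYPE(real) (N * N) ())"
    using Q by (auto simp: Units_def ring_mat_simps)
  then obtain X where X: "mat_inverse Q = Some X"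
    using mat_inverse(1)[OF Q, where b = "()"] by (cases "mat_inverse Q") auto
  then show "Qi \<in> carrier_mat (N * N) (N * N)" "Q * Qi = 1\<^sub>m (N * N)" "Qi * Q = 1\<^sub>m (N * N)"
    using mat_inverse(2)[OF Q X] by (simp_all add: Qi_def)
  show "Q * transpose_mat Q = kron_mat (transpose_mat F * F) (1\<^sub>m N)"
    using F by (simp add: Q_def transpose_kron_mat kron_mat_mult)
  have "(transpose_mat F * F) * (Fi * transpose_mat Fi) = 1\<^sub>m N"
  proof -
    have "(transpose_mat F * F) * (Fi * transpose_mat Fi) =
        transpose_mat F * ((F * Fi) * transpose_mat Fi)"
      using F Fi(1) by (simp add: assoc_mult_mat[of _ N N _ N _ N])
    then show ?thesis using Fi FT by simp
  qed
  then show "\<exists>R\<in>carrier_mat N N. (transpose_mat F * F) * R = 1\<^sub>m N"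
    using Fi(1) by (intro bexI[of _ "Fi * transpose_mat Fi"]) auto
qed

lemma G_mat_eq:
  assumes "P \<in> carrier_mat N N"
  shows "G_mat N P H K \<mu> = lyap_stack N P H + lyap_stack N P (gauge_mat N K \<mu>)"
  unfolding G_mat_def using assms by (intro lyap_stack_add) (simp_all add: gauge_mat_def)

lemma Gr_mat_eq:
  assumes H: "H \<in> carrier_mat N (N * N)"
  shows "Gr_mat N d P H K B \<nu> = lyap_stack N P H + reduced_stack N B \<nu>"
proof -
  have "H + gauge_mat N K (0\<^sub>v d) = H"
    using H by (simp add: gauge_mat_def lin_comb_zero)
  then show ?thesis by (simp add: Gr_mat_def G_mat_def)
qed

lemma gauge_preserves_field:
  assumes K: "gauge_basis N d K" and H: "H \<in> carrier_mat N (N * N)"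
    and \<mu>: "\<mu> \<in> carrier_vec d" and w: "w \<in> carrier_vec N"
  shows "(H + gauge_mat N K \<mu>) *\<^sub>v kron_vec w w = H *\<^sub>v kron_vec w w"
proof -
  have "gauge_mat N K \<mu> \<in> gauge_space N"
    unfolding gauge_mat_def using K \<mu> by (intro lin_comb_gauge_space) (auto simp: gauge_basis_def)
  then have gauge: "gauge_mat N K \<mu> \<in> carrier_mat N (N * N)" "gauge_mat N K \<mu> *\<^sub>v kron_vec w w = 0\<^sub>v N"
    using w by (auto simp: gauge_space_def)
  have ww: "kron_vec w w \<in> carrier_vec (N * N)"
    using w by (auto simp: kron_vec_def)
  have "H *\<^sub>v kron_vec w w \<in> carrier_vec N" using H ww by (rule mult_mat_vec_carrier)
  then show ?thesis
    unfolding add_mult_distrib_mat_vec[OF H gauge(1) ww] gauge(2) by (rule right_zero_vec)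
qed

theorem proposition4p2:
  fixes n m N d q :: nat
    and p :: "real vec \<Rightarrow> real vec"
    and \<alpha> :: "nat \<Rightarrow> nat \<Rightarrow> nat"
    and a b :: "nat \<Rightarrow> nat"
    and s :: "nat \<Rightarrow> real vec"
    and A0 H0 H P Pf :: "real mat"
    and K :: "nat \<Rightarrow> real mat"
    and B :: "nat \<Rightarrow> nat \<Rightarrow> real mat"
    and \<Lambda> :: "real vec"
  assumes n: "1 \<le> n"
    and N: "N = n + m"
    and p: "polynomial_map n n p" "p (0\<^sub>v n) = 0\<^sub>v n" "hurwitz (jacobian n n p (0\<^sub>v n))"
    and lift: "inner_quadratic_lift n m \<alpha> a b"
    and reference: "reference_extension n m p \<alpha> A0 H0"
    and s: "\<forall>i<m. s i \<in> carrier_vec (N * N) \<and>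
              (\<forall>w \<in> carrier_vec N. s i \<bullet> kron_vec w w = w $ a i * w $ b i)"
    and d: "d = N\<^sup>2 * (N - 1) div 2"
    and K: "gauge_basis N d K"
    and q: "q = N * (N\<^sup>2 - 1) div 3"
    and B: "cyclic_basis N q B"
    and \<Lambda>: "\<Lambda> \<in> stable_set n m A0"
    and H: "H = H_stab n m s H0 \<Lambda>"
    and P: "lyapunov_certificate N (A_stab n m A0 \<Lambda>) P"
    and Pf: "Pf \<in> carrier_mat N N" "P = transpose_mat Pf * Pf"
  shows
    "(\<exists>\<mu> \<in> carrier_vec d. spectral_norm (J_mat N Pf P H K \<mu>) = phi N d Pf P H K) \<and>
     (phi N d Pf P H K)\<^sup>2 = tau_star N d q P H K B \<and>
     (\<exists>\<nu> \<in> carrier_vec q. \<exists>\<tau>. pd_mat (lmi_mat N d P H K B \<nu> \<tau>)) \<and>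
     (\<exists>\<nu>. sdp_optimal N d q P H K B \<nu> (tau_star N d q P H K B)) \<and>
     (\<forall>\<nu> \<tau>. sdp_optimal N d q P H K B \<nu> \<tau> \<longrightarrow>
        (\<exists>!\<mu>. min_norm_gauge N d P K B \<nu> \<mu>) \<and>
        (\<forall>\<mu>. min_norm_gauge N d P K B \<nu> \<mu> \<longrightarrow>
           (\<forall>w \<in> carrier_vec N.
              (H + gauge_mat N K \<mu>) *\<^sub>v kron_vec w w = H *\<^sub>v kron_vec w w) \<and>
           spectral_norm (J_mat N Pf P H K \<mu>) = phi N d Pf P H K))"
proof -
  have N0: "0 < N" using n N by simp
  have H_carrier: "H \<in> carrier_mat N (N * N)"
    using reference unfolding H H_stab_def N reference_extension_def by simp
  have P': "P \<in> carrier_mat N N" "pd_mat P" "symmetric_mat P"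
    using P by (auto simp: lyapunov_certificate_def pd_mat_def)
  define Q where "Q = kron_mat (transpose_mat Pf) (1\<^sub>m N)"
  define Qi where "Qi = the (mat_inverse Q)"
  note Q = kron_factor_inverse[OF Pf(1) P'(2)[unfolded Pf(2)] Q_def Qi_def, folded Pf(2)]
  obtain R where R: "R \<in> carrier_mat N N" "P * R = 1\<^sub>m N" using Q(6) by blast
  define V where "V = col_stack N ` cyclic_space N"
  define L where "L \<mu> = lyap_stack N P (gauge_mat N K \<mu>)" for \<mu>
  define val where "val Y = spectral_norm (Qi * (lyap_stack N P H + Y))" for Y
  have L_image: "L ` carrier_vec d = V"
    unfolding L_def V_def by (rule lyap_stack_gauge_image[OF P'(1,3) R K])
  have R_image: "reduced_stack N B ` carrier_vec q = V"
    unfolding V_def by (rule reduced_stack_image[OF B])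
  have V: "V \<subseteq> carrier_mat (N * N) N" by (auto simp: V_def col_stack_def)
  have "V \<noteq> {}" unfolding L_image[symmetric] using zero_carrier_vec by blast
  then have "\<exists>Y\<in>V. \<forall>Y'\<in>V. val Y \<le> val Y'"
    unfolding val_def
  proof (rule whitened_norm_attains_minimum[OF Q(1-4) lyap_stack_carrier V])
    fix Y M
    assume "\<And>i. Y i \<in> V" "M \<in> carrier_mat (N * N) N"
      "\<And>r s. r < N * N \<Longrightarrow> s < N \<Longrightarrow> (\<lambda>i. Y i $$ (r, s)) \<longlonglongrightarrow> M $$ (r, s)"
    then show "M \<in> V" unfolding V_def by (rule col_stack_cyclic_closed)
  qed
  then obtain Y where Y: "Y \<in> V" "\<And>Y'. Y' \<in> V \<Longrightarrow> val Y \<le> val Y'" by blast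
  have val_nonneg: "0 \<le> val Y'" for Y' by (simp add: val_def spectral_norm_nonneg)

  \<comment> \<open>both optimization problems minimize \<open>val\<close> over \<open>V\<close>: here in the parameter \<open>\<mu>\<close>, below in \<open>\<nu>\<close>\<close>
  have J: "spectral_norm (J_mat N Pf P H K \<mu>) = val (L \<mu>)" for \<mu>
    unfolding J_mat_def G_mat_eq[OF P'(1)] val_def L_def Qi_def Q_def ..
  have "(\<lambda>\<mu>. spectral_norm (J_mat N Pf P H K \<mu>)) ` carrier_vec d = val ` V"
    unfolding J L_image[symmetric] image_image ..
  then have phi: "phi N d Pf P H K = val Y"
    unfolding phi_def using Y by (subst cInf_eq_minimum[of "val Y"]) auto

  have lmi: "lmi_mat N d P H K B \<nu> \<tau> =
      four_block_mat (Q * transpose_mat Q) (Q * (Qi * (lyap_stack N P H + reduced_stack N B \<nu>)))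
        (transpose_mat (Q * (Qi * (lyap_stack N P H + reduced_stack N B \<nu>)))) (\<tau> \<cdot>\<^sub>m 1\<^sub>m N)"
    and whitened: "Qi * (lyap_stack N P H + reduced_stack N B \<nu>) \<in> carrier_mat (N * N) N" for \<nu> \<tau>
  proof -
    have G: "lyap_stack N P H + reduced_stack N B \<nu> \<in> carrier_mat (N * N) N"
      by (simp add: reduced_stack_def)
    have cancel: "Q * (Qi * (lyap_stack N P H + reduced_stack N B \<nu>)) =
        lyap_stack N P H + reduced_stack N B \<nu>"
      using assoc_mult_mat[OF Q(1,2) G] unfolding Q(3) left_mult_one_mat[OF G] by (rule sym)
    show "lmi_mat N d P H K B \<nu> \<tau> =
      four_block_mat (Q * transpose_mat Q) (Q * (Qi * (lyap_stack N P H + reduced_stack N B \<nu>)))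
        (transpose_mat (Q * (Qi * (lyap_stack N P H + reduced_stack N B \<nu>)))) (\<tau> \<cdot>\<^sub>m 1\<^sub>m N)"
      unfolding lmi_mat_def Q(5) Gr_mat_eq[OF H_carrier] cancel ..
    show "Qi * (lyap_stack N P H + reduced_stack N B \<nu>) \<in> carrier_mat (N * N) N"
      using Q(2) G by (rule mult_carrier_mat)
  qed
  have feasible: "sdp_feasible N d q P H K B (\<nu>, \<tau>) \<longleftrightarrow>
      \<nu> \<in> carrier_vec q \<and> (val (reduced_stack N B \<nu>))\<^sup>2 \<le> \<tau>" for \<nu> \<tau>
    unfolding sdp_feasible_def lmi val_def psd_schur_block_iff[OF Q(1-3) whitened N0] by simp
  obtain \<nu>0 where \<nu>0: "\<nu>0 \<in> carrier_vec q" "Y = reduced_stack N B \<nu>0"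
    using Y(1) R_image by blast
  have lower: "(val Y)\<^sup>2 \<le> \<tau>" if "sdp_feasible N d q P H K B (\<nu>, \<tau>)" for \<nu> \<tau>
  proof -
    have "reduced_stack N B \<nu> \<in> V" using that R_image feasible by blast
    then have "(val Y)\<^sup>2 \<le> (val (reduced_stack N B \<nu>))\<^sup>2"
      by (intro power_mono Y(2) val_nonneg)
    then show ?thesis using that feasible by force
  qed
  have optimal0: "sdp_feasible N d q P H K B (\<nu>0, (val Y)\<^sup>2)"
    using \<nu>0 by (simp add: feasible)
  have tau: "tau_star N d q P H K B = (val Y)\<^sup>2"
    unfolding tau_star_def
  proof (rule cInf_eq_minimum)
    show "(val Y)\<^sup>2 \<in> snd ` {z. sdp_feasible N d q P H K B z}"
      using optimal0 by (intro image_eqI[of _ _ "(\<nu>0, (val Y)\<^sup>2)"]) auto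
    fix t assume "t \<in> snd ` {z. sdp_feasible N d q P H K B z}"
    then obtain \<nu> where "sdp_feasible N d q P H K B (\<nu>, t)" by auto
    then show "(val Y)\<^sup>2 \<le> t" by (rule lower)
  qed
  show ?thesis
  proof (intro conjI allI ballI impI)
    obtain \<mu> where "\<mu> \<in> carrier_vec d" "Y = L \<mu>" using Y(1) L_image by blast
    then show "\<exists>\<mu>\<in>carrier_vec d. spectral_norm (J_mat N Pf P H K \<mu>) = phi N d Pf P H K"
      unfolding J phi by blast
    show "(phi N d Pf P H K)\<^sup>2 = tau_star N d q P H K B"
      unfolding phi tau ..
    \<comment> \<open>any \<open>\<tau>\<close> above the squared norm is strictly feasible\<close>
    have "pd_mat (lmi_mat N d P H K B \<nu>0 ((val Y)\<^sup>2 + 1))"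
      unfolding lmi by (rule pd_schur_block[OF Q(1-3) whitened N0]) (simp add: val_def \<nu>0(2))
    then show "\<exists>\<nu>\<in>carrier_vec q. \<exists>\<tau>. pd_mat (lmi_mat N d P H K B \<nu> \<tau>)"
      using \<nu>0(1) by blast
    show "\<exists>\<nu>. sdp_optimal N d q P H K B \<nu> (tau_star N d q P H K B)"
      unfolding tau sdp_optimal_def is_arg_min_linorder using optimal0 lower by auto
  next
    fix \<nu> \<tau> assume "sdp_optimal N d q P H K B \<nu> \<tau>"
    then have \<nu>: "sdp_feasible N d q P H K B (\<nu>, \<tau>)" and "\<tau> \<le> (val Y)\<^sup>2"
      using optimal0 unfolding sdp_optimal_def is_arg_min_linorder by force+
    then have "(val (reduced_stack N B \<nu>))\<^sup>2 \<le> (val Y)\<^sup>2" using feasible by force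
    then have "val (reduced_stack N B \<nu>) \<le> val Y" using val_nonneg by (rule power2_le_imp_le)
    moreover have in_V: "reduced_stack N B \<nu> \<in> V" using \<nu> R_image feasible by blast
    ultimately have val_\<nu>: "val (reduced_stack N B \<nu>) = val Y" using Y(2) by force
    \<comment> \<open>consistency of the linear problem: the optimal stack lies in the image of the gauge\<close>
    obtain \<mu>0 where \<mu>0: "\<mu>0 \<in> carrier_vec d" "L \<mu>0 = reduced_stack N B \<nu>"
      using in_V L_image by force
    show "\<exists>!\<mu>. min_norm_gauge N d P K B \<nu> \<mu>"
      unfolding min_norm_gauge_def gauge_mat_def lyap_stack_lin_comb[OF P'(1)]
      by (rule minimum_norm_solution_exists_unique[OF \<mu>0(1)])
        (use \<mu>0(2) in \<open>simp add: L_def gauge_mat_def lyap_stack_lin_comb[OF P'(1)]\<close>)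
    fix \<mu> assume "min_norm_gauge N d P K B \<nu> \<mu>"
    then have \<mu>: "\<mu> \<in> carrier_vec d" "L \<mu> = reduced_stack N B \<nu>"
      by (auto simp: min_norm_gauge_def is_arg_min_def L_def)
    show "spectral_norm (J_mat N Pf P H K \<mu>) = phi N d Pf P H K"
      unfolding J phi \<mu>(2) val_\<nu> ..
    fix w :: "real vec" assume "w \<in> carrier_vec N"
    then show "(H + gauge_mat N K \<mu>) *\<^sub>v kron_vec w w = H *\<^sub>v kron_vec w w"
      by (rule gauge_preserves_field[OF K H_carrier \<mu>(1)])
  qed
qed

end
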